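(* (i) Let $d \geq 2$ and consider the competing frog model on $\mathbb{Z}^d$ with $2^d$ types, where type $i$ has laziness parameter $p_i \in (0,1]$ for $1 \leq i \leq 2^d$. Let $\tilde{p} = \min\{p_1, \dots, p_{2^d}\}$. Fix $2^d$ distinct points $\mathbf{x}_1, \dots, \mathbf{x}_{2^d} \in \mathbb{Z}^d$ such that, for each $1 \leq i \leq 2^d$, the site $\mathbf{x}_i$ has a single active type $i$ particle at time $0$, and let $\mathbb{P}_{\mathbf{x}_1, \dots, \mathbf{x}_{2^d}}$ denote the corresponding law. Then there exist $M \in \mathbb{N}$, depending only on $\tilde{p}$ and $d$, and $\gamma_1 \in (0,1)$ (neither depending on the law of $\eta$) such that, whenever the i.i.d. initial configuration satisfies $\mathbb{P}(\eta(\mathbf{0}) \geq M) \geq \gamma_1$, coexistence of all $2^d$ types has positive probability: $$\mathbb{P}_{\mathbf{x}_1, \dots, \mathbf{x}_{2^d}}\bigl(|N_n(i)| \to \infty \text{ as } n\to\infty \text{ for every } 1 \leq i \leq 2^d\bigr) > 0.$$ (ii) Let $d \geq 3$ and consider the competing frog model on $\mathbb{Z}^d$ with infinitely many types $i = 1, 2, \dots$, where type $i$ has laziness parameter $p_i\in(0,1]$ and $\inf\{p_i : i \geq 1\} = p_0 \in (0,1]$. Let $\mathbf{x}_i \in \mathbb{Z}^d$, $i \geq 1$, be distinct sites such that $\mathbf{x}_{i_1}(j) = \mathbf{x}_{i_2}(j)$ for all $i_1, i_2 \geq 1$ and all $1 \leq j \leq d-1$, where $\mathbf{x}(j)$ denotes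 the $j$-th coordinate of $\mathbf{x}$, and suppose that at time $0$ each site $\mathbf{x}_i$ has one active particle, of type $i$. Then there exist $M \in \mathbb{N}$, depending only on $p_0$ and $d$, and $\gamma_2 \in (0,1)$ (neither depending on the law of $\eta$) such that, whenever the i.i.d. initial configuration satisfies $\mathbb{P}(\eta(\mathbf{0}) \geq M) \geq \gamma_2$, coexistence of infinitely many types has positive probability, i.e. with positive probability there are infinitely many indices $i$ such that $|N_n(i)| \to \infty$ as $n \to \infty$. Both parts hold for any tie-breaking mechanism.
   Context: Multi-type competing frog model on $\mathbb{Z}^d$ with a finite or countably infinite set of types, type $i$ having laziness parameter $p_i\in(0,1]$: distinct starting sites $\mathbf{x}_i$, one for each type $i$, are given. At time $0$, for each $i$ there is exactly one particle at $\mathbf{x}_i$, and it is active and of type $i$; every site $\mathbf{x}$ that is not a starting site contains $\eta(\mathbf{x})$ dormant particles, where $\{\eta(\mathbf{x}):\mathbf{x}\in\mathbb{Z}^d\}$ (the initial configuration) is a family of i.i.d. non-negative integer valued random variables, independent of all the random movements described next. Time is discrete. At each time step, independently of everything else, each active particle of type $i$ stays at its present site with probability $1-p_i$, and with probability $p_i$ moves to a uniformly chosen one of the $2d$ nearest neighbours of its present site. Dormant particles do not move. When a site that is not a starting site is first hit by active particle(s) (at time $n$, say), all dormant particles there become active at time $n$ (and make their first step between times $n$ and $n+1$). If all the particles arriving at that time have the same type $i$, the newly activated particles get type $i$. If particles of more than one type arrive at that time, the types of the newly activated particles are decided by a tie-breaking mechanism, i.e. an arbitrary fixed rule (deterministic,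 or using the history of the process up to time $n$ and additional independent randomness) assigning to each newly activated particle one of the types that arrived. Once active, a particle stays active and never changes type. $N_n(i)$ is the set of active type $i$ particles at time $n$, and $|N_n(i)|$ is its cardinality. *)

theory Defs
  imports "HOL-Probability.Probability"
begin

text \<open>
  Types of particles are natural numbers, taken from an index set \<open>I\<close>; \<open>x i\<close> is the starting site of
  type \<open>i\<close>. The particle \<open>(z, k)\<close> is the \<open>k\<close>-th particle initially located at the site \<open>z\<close>. A
  configuration maps each active particle to its present site and type, and all other particles
  (dormant ones as well as labels \<open>(z, k)\<close> to which no particle corresponds) to \<open>None\<close>.
\<close>

type_synonym 'd site = "int ^ 'd"
type_synonym 'd particle = "'d site \<times> nat"
type_synonym 'd config = "'d particle \<Rightarrow> ('d site \<times> nat) option"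

text \<open>
  A rule receives the time \<open>n\<close>, the initial configuration, the history up to time \<open>n\<close>, the value of
  the additional randomness and the particle to be activated. The additional randomness is a single
  real random variable of arbitrary law.
\<close>

type_synonym 'd tie_rule =
  "nat \<Rightarrow> ('d site \<Rightarrow> nat) \<Rightarrow> (nat \<Rightarrow> 'd config) \<Rightarrow> real \<Rightarrow> 'd particle \<Rightarrow> nat"

text \<open>
  An outcome consists of the initial configuration \<open>\<eta>\<close>, the displacements \<open>\<xi>\<close> and the additional
  randomness \<open>u\<close>. The particle \<open>q\<close>, if active and of type \<open>i\<close> at time \<open>n\<close>, is displaced by \<open>\<xi> (q, i, n)\<close>
  between times \<open>n\<close> and \<open>n + 1\<close>; as the law of a displacement depends on the type, there is one
  independent family of displacements for each type that the particle may get.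
\<close>

type_synonym 'd outcome =
  "('d site \<Rightarrow> nat) \<times> ('d particle \<times> nat \<times> nat \<Rightarrow> 'd site) \<times> real"

definition unit_steps :: "('d::finite) site set" where
  "unit_steps = {v. \<exists>j. v = axis j 1 \<or> v = axis j (- 1)}"

definition lazy_step :: "real \<Rightarrow> ('d::finite) site pmf" where
  "lazy_step r =
     bind_pmf (bernoulli_pmf r) (\<lambda>b. if b then pmf_of_set unit_steps else return_pmf 0)"

definition frog_measure ::
    "nat pmf \<Rightarrow> (nat \<Rightarrow> real) \<Rightarrow> real measure \<Rightarrow> ('d::finite) outcome measure" where
  "frog_measure \<mu> p \<nu> =
     (\<Pi>\<^sub>M z\<in>UNIV. measure_pmf \<mu>) \<Otimes>\<^sub>M
     ((\<Pi>\<^sub>M (q, i, n)\<in>UNIV. measure_pmf (lazy_step (p i))) \<Otimes>\<^sub>M \<nu>)"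

definition types_at :: "('d::finite) config \<Rightarrow> 'd site \<Rightarrow> nat set" where
  "types_at c z = {i. \<exists>q. c q = Some (z, i)}"

definition init_config :: "nat set \<Rightarrow> (nat \<Rightarrow> ('d::finite) site) \<Rightarrow> 'd config" where
  "init_config I x = (\<lambda>(z, k). if z \<in> x ` I \<and> k = 0 then Some (z, the_inv_into I x z) else None)"

definition move ::
    "('d particle \<times> nat \<times> nat \<Rightarrow> 'd site) \<Rightarrow> nat \<Rightarrow> ('d::finite) config \<Rightarrow> 'd config" where
  "move \<xi> n c = (\<lambda>q. map_option (\<lambda>(z, i). (z + \<xi> (q, i, n), i)) (c q))"

text \<open>
  Activation at time \<open>n\<close>, where \<open>h n\<close> holds the particles activated before time \<open>n\<close>, at their
  positions at time \<open>n\<close>. A particle of \<open>z\<close> is still inactive at that moment only if \<open>z\<close> has not been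
  visited before time \<open>n\<close>, so that \<open>types_at (h n) z\<close> is the set of types arriving at \<open>z\<close>.
\<close>

definition activate ::
    "nat set \<Rightarrow> (nat \<Rightarrow> 'd site) \<Rightarrow> 'd tie_rule \<Rightarrow> ('d site \<Rightarrow> nat) \<Rightarrow> real
      \<Rightarrow> nat \<Rightarrow> (nat \<Rightarrow> ('d::finite) config) \<Rightarrow> 'd config" where
  "activate I x \<tau> \<eta> u n h = (\<lambda>(z, k).
     case h n (z, k) of
       Some a \<Rightarrow> Some a
     | None \<Rightarrow>
         let A = types_at (h n) z in
         if z \<notin> x ` I \<and> k < \<eta> z \<and> A \<noteq> {}
         then Some (z, if is_singleton A then the_elem A else \<tau> n \<eta> h u (z, k))
         else None)"

text \<open>
  \<open>history I x \<tau> \<omega> n\<close> lists the configurations at times \<open>0, \<dots>, n\<close>, padded by the empty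
  configuration. The tie-breaking rule used at time \<open>n + 1\<close> sees the configurations at times
  \<open>0, \<dots>, n\<close> and, at time \<open>n + 1\<close>, the one just before activation.
\<close>

primrec history ::
    "nat set \<Rightarrow> (nat \<Rightarrow> ('d::finite) site) \<Rightarrow> 'd tie_rule \<Rightarrow> 'd outcome
      \<Rightarrow> nat \<Rightarrow> nat \<Rightarrow> 'd config" where
  "history I x \<tau> \<omega> 0 = (\<lambda>_ _. None)(0 := init_config I x)"
| "history I x \<tau> \<omega> (Suc n) =
     (case \<omega> of (\<eta>, \<xi>, u) \<Rightarrow>
        let h = (history I x \<tau> \<omega> n)(Suc n := move \<xi> n (history I x \<tau> \<omega> n n))
        in h(Suc n := activate I x \<tau> \<eta> u (Suc n) h))"

definition active_particles ::
    "nat set \<Rightarrow> (nat \<Rightarrow> ('d::finite) site) \<Rightarrow> 'd tie_rule \<Rightarrow> 'd outcome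
      \<Rightarrow> nat \<Rightarrow> nat \<Rightarrow> 'd particle set" where
  "active_particles I x \<tau> \<omega> n i = {q. \<exists>z. history I x \<tau> \<omega> n n q = Some (z, i)}"

definition survives ::
    "nat set \<Rightarrow> (nat \<Rightarrow> ('d::finite) site) \<Rightarrow> 'd tie_rule \<Rightarrow> 'd outcome \<Rightarrow> nat \<Rightarrow> bool" where
  "survives I x \<tau> \<omega> i \<longleftrightarrow>
     filterlim (\<lambda>n. card (active_particles I x \<tau> \<omega> n i)) at_top sequentially"

definition tie_breaking :: "('d::finite) tie_rule \<Rightarrow> bool" where
  "tie_breaking \<tau> \<longleftrightarrow>
     (\<forall>n \<eta> h u q. types_at (h n) (fst q) \<noteq> {} \<longrightarrow> \<not> is_singleton (types_at (h n) (fst q)) \<longrightarrow>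
        \<tau> n \<eta> h u q \<in> types_at (h n) (fst q)) \<and>
     (\<forall>n q. (\<lambda>(\<eta>, h, u). \<tau> n \<eta> h u q) \<in>
        (\<Pi>\<^sub>M z\<in>UNIV. count_space UNIV) \<Otimes>\<^sub>M
        ((\<Pi>\<^sub>M m\<in>UNIV. \<Pi>\<^sub>M q'\<in>UNIV. count_space UNIV) \<Otimes>\<^sub>M borel)
        \<rightarrow>\<^sub>M count_space UNIV)"

end

theory Submission
  imports Defs
begin

text \<open>
  A cell of a quadrant of an affine lattice plane is called open for type \<open>i\<close> if its site holds at
  least \<open>M\<close> particles and, at the earliest time at which type \<open>i\<close> can arrive there, one of the first
  \<open>M\<close> of them steps in each of the two directions spanning the quadrant. Along an oriented open path
  type \<open>i\<close> then advances at the maximal speed 1, so no other type reaches a site of the path before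
  or together with type \<open>i\<close>, whatever the tie-breaking rule; hence type \<open>i\<close> survives as soon as
  oriented site percolation occurs, and a contour argument bounds the probability that it does not.

  In (i) a finite initial phase first brings type \<open>i\<close> from its starting site to a translate of the
  corner \<open>R \<epsilon>\<^sub>i\<close> of a large cube, from where it conquers a quadrant pointing outwards. During this
  phase all particles of type \<open>j\<close>, including the newly activated ones, are prescribed to follow the
  same route, so that they always share a single site and ties do not matter. This event has positive
  probability and involves other coordinates than the percolation. In (ii) parallel planes transversal
  to the line through the starting sites serve as territories; the probability that type \<open>i\<close>
  survives is bounded below uniformly in \<open>i\<close>, so infinitely many types survive with positive
  probability.
\<close>

subsection \<open>A contour bound for oriented site percolation\<close>

type_synonym cell = "int \<times> int"

text \<open>Oriented site percolation: the ends of open paths from the origin with \<open>n\<close>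
  steps to the right or up. The origin itself has to be open.\<close>

primrec wet_level :: "(cell \<Rightarrow> bool) \<Rightarrow> nat \<Rightarrow> cell set" where
  "wet_level op 0 = {z. z = (0, 0) \<and> op z}"
| "wet_level op (Suc n) =
     {z. op z \<and> (z - (1, 0) \<in> wet_level op n \<or> z - (0, 1) \<in> wet_level op n)}"

lemma wet_levelD:
  "z \<in> wet_level op n \<Longrightarrow> op z \<and> 0 \<le> fst z \<and> 0 \<le> snd z \<and> fst z + snd z = int n"
  by (induction n arbitrary: z) force+

lemma finite_wet_level: "finite (wet_level op n)"
proof (rule finite_subset)
  show "wet_level op n \<subseteq> {0..int n} \<times> {0..int n}"
    using wet_levelD[of _ op n] by (force simp: mem_Times_iff)
qed simp

lemma wet_level_empty_mono: "wet_level op n = {} \<Longrightarrow> n \<le> m \<Longrightarrow> wet_level op m = {}"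
  by (induction m) (auto simp: le_Suc_eq)

text \<open>
  A directed boundary edge of a set \<open>W\<close> of cells is a pair \<open>(z, d)\<close> with \<open>z \<in> W\<close> and
  \<open>z + d \<notin> W\<close>; it is traversed in the direction \<open>quarter_turn d\<close>, so with \<open>W\<close> on its left.
\<close>

definition quarter_turn :: "cell \<Rightarrow> cell" where
  "quarter_turn d = (- snd d, fst d)"

definition unit_cells :: "cell set" where
  "unit_cells = {(1, 0), (0, 1), (-1, 0), (0, -1)}"

definition turn_left :: "cell \<times> cell \<Rightarrow> cell \<times> cell" where
  "turn_left = (\<lambda>(z, d). (z, quarter_turn d))"

definition go_straight :: "cell \<times> cell \<Rightarrow> cell \<times> cell" where
  "go_straight = (\<lambda>(z, d). (z + quarter_turn d, d))"

definition turn_right :: "cell \<times> cell \<Rightarrow> cell \<times> cell" where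
  "turn_right = (\<lambda>(z, d). (z + d + quarter_turn d, - quarter_turn d))"

definition boundary_edges :: "cell set \<Rightarrow> (cell \<times> cell) set" where
  "boundary_edges W = {(z, d). d \<in> unit_cells \<and> z \<in> W \<and> z + d \<notin> W}"

text \<open>Where two cells of \<open>W\<close> touch only diagonally, the left turn is preferred
  and the walk stays at its cell. A fixed rule at such vertices makes the walk reversible.\<close>

definition next_edge :: "cell set \<Rightarrow> cell \<times> cell \<Rightarrow> cell \<times> cell" where
  "next_edge W = (\<lambda>(z, d).
     if z + quarter_turn d \<notin> W then turn_left (z, d)
     else if z + d + quarter_turn d \<notin> W then go_straight (z, d)
     else turn_right (z, d))"

lemmas turn_defs = turn_left_def go_straight_def turn_right_def quarter_turn_def

lemma finite_boundary_edges: "finite W \<Longrightarrow> finite (boundary_edges W)"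
  by (rule finite_subset[of _ "W \<times> unit_cells"]) (auto simp: boundary_edges_def unit_cells_def)

lemma next_edge_boundary:
  assumes "e \<in> boundary_edges W"
  shows "next_edge W e \<in> boundary_edges W"
proof -
  obtain a b d where e: "e = ((a, b), d)" by (metis prod.exhaust)
  from assms show ?thesis unfolding e
    by (auto simp: boundary_edges_def next_edge_def turn_defs unit_cells_def)
qed

lemma next_edge_cases: "next_edge W e \<in> {turn_left e, go_straight e, turn_right e}"
  by (auto simp: next_edge_def split: prod.split)

text \<open>The same walk run backwards, with the matching rule at diagonal contacts.\<close>

definition previous_edge :: "cell set \<Rightarrow> cell \<times> cell \<Rightarrow> cell \<times> cell" where
  "previous_edge W = (\<lambda>(z, d).
     if z - quarter_turn d \<notin> W then (z, - quarter_turn d)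
     else if z - quarter_turn d + d \<notin> W then (z - quarter_turn d, d)
     else (z - quarter_turn d + d, quarter_turn d))"

text \<open>Injectivity makes every orbit in the finite set of boundary edges a pure cycle, so the
  walk from the edge below the origin returns to that edge.\<close>

lemma inj_on_next_edge: "inj_on (next_edge W) (boundary_edges W)"
proof (rule inj_on_inverseI)
  fix e assume e: "e \<in> boundary_edges W"
  obtain a b d where d: "e = ((a, b), d)" by (metis prod.exhaust)
  with e have "d \<in> unit_cells" by (simp add: boundary_edges_def)
  then consider "d = (1, 0)" | "d = (0, 1)" | "d = (-1, 0)" | "d = (0, -1)"
    by (auto simp: unit_cells_def)
  then show "previous_edge W (next_edge W e) = e"
    by cases (use e in \<open>simp_all add: d boundary_edges_def next_edge_def previous_edge_def turn_defs
      uminus_prod_def\<close>)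
qed

text \<open>
  Half of a linear functional of the initial vertex of the edge, in doubled coordinates; its total
  increment around a cycle therefore vanishes.
\<close>

definition edge_potential :: "cell \<times> cell \<Rightarrow> int" where
  "edge_potential = (\<lambda>(z, d). snd z - fst z - fst d)"

text \<open>Whatever the turn, the next edge starts where this one ends, so the increment depends on
  \<open>d\<close> alone.\<close>

lemma edge_potential_next:
  "edge_potential (next_edge W (z, d)) = edge_potential (z, d) + (fst d + snd d)"
  by (auto simp: next_edge_def turn_defs edge_potential_def)

text \<open>A finite orbit repeats, injectivity carries the repetition back to \<open>x\<close>, and
  no point recurs before the least positive return time.\<close>

lemma funpow_cycle:
  assumes "finite S" "inj_on f S" "f ` S \<subseteq> S" "x \<in> S"
  obtains n where "0 < n" "(f ^^ n) x = x" "inj_on (\<lambda>k. (f ^^ k) x) {..<n}"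
proof -
  have S: "(f ^^ k) x \<in> S" for k
    using assms by (induction k) auto
  have "\<not> inj_on (\<lambda>k. (f ^^ k) x) (UNIV :: nat set)"
    using S assms(1) by (meson finite_subset finite_imageD image_subsetI infinite_UNIV_nat)
  then obtain i j where ij: "(f ^^ i) x = (f ^^ j) x" "i < j"
    unfolding inj_on_def by (metis linorder_neqE_nat)
  have shift: "(f ^^ i) x = (f ^^ j) x \<Longrightarrow> i \<le> j \<Longrightarrow> (f ^^ (j - i)) x = x" for i j
  proof (induction i arbitrary: j)
    case (Suc i)
    then obtain j' where j: "j = Suc j'" by (cases j) auto
    have "(f ^^ i) x = (f ^^ j') x"
      using Suc.prems(1) S assms(2) unfolding j by (auto dest: inj_onD)
    with Suc j show ?case by auto
  qed simp
  have ex: "\<exists>n. 0 < n \<and> (f ^^ n) x = x"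
    using shift[OF ij(1)] ij(2) by (intro exI[of _ "j - i"]) auto
  define n where "n = (LEAST n. 0 < n \<and> (f ^^ n) x = x)"
  have n: "0 < n" "(f ^^ n) x = x"
    using LeastI_ex[OF ex] by (auto simp: n_def)
  have "(f ^^ i) x \<noteq> (f ^^ j) x" if "i < j" "j < n" for i j
    using shift[of i j] that not_less_Least[of "j - i" "\<lambda>n. 0 < n \<and> (f ^^ n) x = x"]
    by (auto simp: n_def)
  then have "inj_on (\<lambda>k. (f ^^ k) x) {..<n}"
    by (intro inj_onI) (metis lessThan_iff linorder_neqE_nat)
  with n show thesis using that by blast
qed

text \<open>Contours list their edges in reverse order, the edge below the origin being the last entry.\<close>

primrec contours :: "nat \<Rightarrow> (cell \<times> cell) list set" where
  "contours 0 = {[((0, 0), (0, -1))]}"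
| "contours (Suc n) =
     (\<Union>es \<in> contours n. (\<lambda>e. e # es) ` {turn_left (hd es), go_straight (hd es), turn_right (hd es)})"

text \<open>Only edges facing right or up count: the cell across such an edge is one oriented step
  away from the cluster and outside it, hence closed.\<close>

definition blocked_cells :: "(cell \<times> cell) list \<Rightarrow> cell set" where
  "blocked_cells es = (\<lambda>(z, d). z + d) ` {e \<in> set es. snd e \<in> {(1, 0), (0, 1)}}"

lemma finite_contours: "finite (contours n)"
  by (induction n) auto

lemma card_contours: "card (contours n) \<le> 3 ^ n"
proof (induction n)
  case (Suc n)
  have "card (contours (Suc n)) \<le>
      (\<Sum>es\<in>contours n. card ((\<lambda>e. e # es) ` {turn_left (hd es), go_straight (hd es), turn_right (hd es)}))"
    using finite_contours by (simp add: card_UN_le)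
  also have "\<dots> \<le> (\<Sum>es\<in>contours n. 3)"
    by (intro sum_mono order_trans[OF card_image_le]) (auto simp: card_insert_if)
  finally show ?case using Suc by simp
qed simp

lemma finite_blocked_cells: "finite (blocked_cells es)"
  by (simp add: blocked_cells_def)

text \<open>
  Since \<open>edge_potential\<close> changes by \<open>+1\<close> along edges facing up or right and by \<open>-1\<close> along the
  others, half of the edges of a cycle face a cell that could be wet but is not. A cell is faced by
  at most two of them, whence the factor 4.
\<close>

lemma contour_of_finite_cluster:
  assumes W: "finite W" "(0, 0) \<in> W" "W \<subseteq> {z. 0 \<le> fst z \<and> 0 \<le> snd z}"
    and closed: "\<And>z d. z \<in> W \<Longrightarrow> d \<in> {(1, 0), (0, 1)} \<Longrightarrow> z + d \<notin> W \<Longrightarrow> C (z + d)"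
  shows "\<exists>n. \<exists>es\<in>contours n. n < 4 * card (blocked_cells es) \<and>
           (\<forall>z\<in>blocked_cells es. C z \<and> 0 \<le> fst z \<and> 0 \<le> snd z)"
proof -
  define e where "e k = (next_edge W ^^ k) ((0, 0), (0, -1))" for k
  have e0: "((0, 0), (0, -1)) \<in> boundary_edges W"
    using W by (auto simp: boundary_edges_def unit_cells_def)
  obtain n where n: "0 < n" "e n = e 0" and inj: "inj_on e {..<n}"
    using funpow_cycle[OF finite_boundary_edges[OF W(1)] inj_on_next_edge _ e0] next_edge_boundary
    by (auto simp: e_def[abs_def] image_subset_iff)
  have bd: "e k \<in> boundary_edges W" for k
    by (induction k) (auto simp: e_def e0 next_edge_boundary)
  define s where "s k = fst (snd (e k)) + snd (snd (e k))" for k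
  have s: "s k = 1 \<or> s k = -1" for k
    using bd[of k] by (auto simp: s_def boundary_edges_def unit_cells_def)
  have pot: "edge_potential (e (Suc k)) = edge_potential (e k) + s k" for k
    using edge_potential_next[of W "fst (e k)" "snd (e k)"] by (simp add: e_def s_def)
  have "edge_potential (e k) = edge_potential (e 0) + (\<Sum>j<k. s j)" for k
    by (induction k) (simp_all add: pot)
  from this[of n] n have sum0: "(\<Sum>j<n. s j) = 0" by simp
  define P where "P = {k\<in>{..<n}. s k = 1}"
  \<comment> \<open>Since \<open>s\<close> takes only the values 1 and -1, the vanishing sum says
    that exactly half of the edges lie in \<open>P\<close>.\<close>
  have "(\<Sum>j<n. s j) = (\<Sum>j<n. 2 * of_bool (s j = 1) - 1)"
    by (intro sum.cong) (use s in auto)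
  also have "\<dots> = 2 * int (card P) - int n"
    by (simp add: sum_subtractf sum_distrib_left[symmetric] P_def sum.If_cases Int_def of_bool_def)
  finally have P: "2 * card P = n" using sum0 by simp
  define es where "es k = rev (map e [0..<Suc k])" for k
  have es: "es k \<in> contours k" for k
  proof (induction k)
    case (Suc k)
    have "hd (es k) = e k" "es (Suc k) = e (Suc k) # es k"
      by (simp_all add: es_def)
    moreover have "e (Suc k) = next_edge W (e k)" by (simp add: e_def)
    ultimately show ?case
      using Suc next_edge_cases[of W "e k"] by (simp only: contours.simps) (intro UN_I[OF Suc], simp)
  qed (simp add: es_def e_def)
  have set_es: "set (es (n - 1)) = e ` {..<n}"
    using n by (auto simp: es_def simp del: upt_Suc)
  have up: "snd (e k) \<in> {(1, 0), (0, 1)}" if "k \<in> P" for k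
    using bd[of k] that by (auto simp: P_def s_def boundary_edges_def unit_cells_def)
  \<comment> \<open>For a fixed direction the faced cell determines the edge, so the two directions
    together count each blocked cell at most twice.\<close>
  define PX where "PX c = {k\<in>P. snd (e k) = c}" for c
  have "P = PX (1, 0) \<union> PX (0, 1)" using up by (auto simp: PX_def)
  then have PX: "card P \<le> card (PX (1, 0)) + card (PX (0, 1))"
    by (metis card_Un_le)
  have card_PX: "card (PX c) \<le> card (blocked_cells (es (n - 1)))" for c
  proof (rule card_inj_on_le)
    show "inj_on (\<lambda>k. fst (e k) + snd (e k)) (PX c)"
      using inj by (auto simp: PX_def P_def inj_on_def prod_eq_iff)
    show "(\<lambda>k. fst (e k) + snd (e k)) ` PX c \<subseteq> blocked_cells (es (n - 1))"
    proof (rule image_subsetI)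
      fix k assume "k \<in> PX c"
      then have "k \<in> P" "k < n" by (auto simp: PX_def P_def)
      then show "fst (e k) + snd (e k) \<in> blocked_cells (es (n - 1))"
        using up unfolding blocked_cells_def set_es case_prod_beta by blast
    qed
  qed (rule finite_blocked_cells)
  \<comment> \<open>The cycle of \<open>n\<close> edges is listed in
    \<open>contours (n - 1)\<close>, as the index counts the edges after the first; hence the strict
    inequality in the conclusion.\<close>
  have "n \<le> 4 * card (blocked_cells (es (n - 1)))"
    using P PX card_PX[of "(1, 0)"] card_PX[of "(0, 1)"] by linarith
  moreover have "C z \<and> 0 \<le> fst z \<and> 0 \<le> snd z" if z: "z \<in> blocked_cells (es (n - 1))" for z
  proof -
    obtain k where k: "z = fst (e k) + snd (e k)" "snd (e k) \<in> {(1, 0), (0, 1)}"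
      using z unfolding blocked_cells_def set_es case_prod_beta by blast
    moreover have "fst (e k) \<in> W" "fst (e k) + snd (e k) \<notin> W"
      using bd[of k] by (auto simp: boundary_edges_def)
    moreover have "0 \<le> fst (fst (e k) + snd (e k))" "0 \<le> snd (fst (e k) + snd (e k))"
      using W(3) calculation(2,3) by auto
    ultimately show ?thesis using closed by metis
  qed
  ultimately show ?thesis using es[of "n - 1"] n(1)
    by (intro exI[of _ "n - 1"] bexI[of _ "es (n - 1)"] conjI ballI) simp_all
qed

text \<open>A dry level leaves all later levels dry, so the wet cluster is finite; a right or upper
  neighbour outside it is closed, as it would otherwise be wet.\<close>

lemma contour_of_dry_level:
  assumes "wet_level op m = {}" "op (0, 0)"
  shows "\<exists>n. \<exists>es\<in>contours n. n < 4 * card (blocked_cells es) \<and>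
           (\<forall>z\<in>blocked_cells es. \<not> op z \<and> 0 \<le> fst z \<and> 0 \<le> snd z)"
proof (rule contour_of_finite_cluster)
  let ?W = "\<Union>n. wet_level op n"
  have "?W \<subseteq> (\<Union>n<m. wet_level op n)"
    using wet_level_empty_mono[OF assms(1)] by (metis (mono_tags) UN_least UN_upper empty_subsetI lessThan_iff linorder_not_le)
  then show "finite ?W"
    by (rule finite_subset) (simp add: finite_wet_level)
  show "(0, 0) \<in> ?W" using assms(2) by (auto intro!: exI[of _ 0])
  show "?W \<subseteq> {z. 0 \<le> fst z \<and> 0 \<le> snd z}" using wet_levelD by blast
  fix z d :: cell
  assume z: "z \<in> ?W" "d \<in> {(1, 0), (0, 1)}" "z + d \<notin> ?W"
  from z(1) obtain n where "z \<in> wet_level op n" by blast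
  then have "op (z + d) \<Longrightarrow> z + d \<in> wet_level op (Suc n)" using z(2) by auto
  then show "\<not> op (z + d)" using z(3) by blast
qed

section \<open>Union bound over contours\<close>

context prob_space
begin

lemma percolation_measurable:
  assumes "\<And>z. {\<omega>\<in>space M. op \<omega> z} \<in> events"
  shows "{\<omega>\<in>space M. \<forall>n. wet_level (op \<omega>) n \<noteq> {}} \<in> events"
proof -
  have [measurable]: "Measurable.pred M (\<lambda>\<omega>. op \<omega> z)" for z
    using assms by (simp add: pred_def)
  have [measurable]: "Measurable.pred M (\<lambda>\<omega>. z \<in> wet_level (op \<omega>) n)" for z n
    by (induction n arbitrary: z) simp_all
  have "Measurable.pred M (\<lambda>\<omega>. \<forall>n. \<exists>z. z \<in> wet_level (op \<omega>) n)" by measurable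
  then show ?thesis by (simp only: pred_def ex_in_conv)
qed

text \<open>Peierls argument relative to an event \<open>E\<close>, which later fixes finitely many
  coordinates. A relevant contour of index \<open>n\<close> blocks more than \<open>n / 4\<close>
  cells and so costs at most \<open>r ^ Suc n\<close>; with at most \<open>3 ^ n\<close> contours
  the series sums to \<open>r / (1 - 3 * r)\<close>, and a closed origin adds
  \<open>r\<close>.\<close>

lemma percolation_fails_le:
  assumes E: "E \<in> events" and op: "\<And>z. {\<omega>\<in>space M. op \<omega> z} \<in> events"
    and r: "0 < r" "3 * r < 1"
    and closed: "\<And>S. finite S \<Longrightarrow> S \<subseteq> {z. 0 \<le> fst z \<and> 0 \<le> snd z} \<Longrightarrow>
      prob {\<omega>\<in>E. \<forall>z\<in>S. \<not> op \<omega> z} \<le> prob E * (r ^ 4) ^ card S"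
  shows "prob {\<omega>\<in>E. \<not> (\<forall>n. wet_level (op \<omega>) n \<noteq> {})} \<le> prob E * (r + r / (1 - 3 * r))"
proof -
  have [measurable]: "Measurable.pred M (\<lambda>\<omega>. op \<omega> z)" for z
    using op by (simp add: pred_def)
  note E[measurable]
  have Esub: "E \<subseteq> space M" using E by (rule sets.sets_into_space)
  have meas: "{\<omega>\<in>E. \<forall>z\<in>S. \<not> op \<omega> z} \<in> events" for S
  proof -
    have "{\<omega>\<in>E. \<forall>z\<in>S. \<not> op \<omega> z} = {\<omega>\<in>space M. \<omega> \<in> E \<and> (\<forall>z\<in>S. \<not> op \<omega> z)}" using Esub by auto
    then show ?thesis by simp
  qed
  define K where "K n = {es\<in>contours n. n < 4 * card (blocked_cells es) \<and>
      blocked_cells es \<subseteq> {z. 0 \<le> fst z \<and> 0 \<le> snd z}}" for n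
  define B where "B n = (\<Union>es\<in>K n. {\<omega>\<in>E. \<forall>z\<in>blocked_cells es. \<not> op \<omega> z})" for n
  have finK: "finite (K n)" for n by (simp add: K_def finite_contours)
  have B: "B n \<in> events" for n unfolding B_def using finK meas by blast
  have prob_B: "prob (B n) \<le> prob E * r * (3 * r) ^ n" for n
  proof -
    have "prob (B n) \<le> (\<Sum>es\<in>K n. prob {\<omega>\<in>E. \<forall>z\<in>blocked_cells es. \<not> op \<omega> z})"
      unfolding B_def using finK meas by (intro measure_UNION_le) auto
    also have "\<dots> \<le> (\<Sum>es\<in>K n. prob E * r ^ Suc n)"
    proof (rule sum_mono)
      fix es assume es: "es \<in> K n"
      have "prob {\<omega>\<in>E. \<forall>z\<in>blocked_cells es. \<not> op \<omega> z} \<le> prob E * (r ^ 4) ^ card (blocked_cells es)"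
        using es by (intro closed finite_blocked_cells) (auto simp: K_def)
      also have "\<dots> \<le> prob E * r ^ Suc n"
        using es r unfolding power_mult[symmetric]
        by (intro mult_left_mono power_decreasing) (auto simp: K_def)
      finally show "prob {\<omega>\<in>E. \<forall>z\<in>blocked_cells es. \<not> op \<omega> z} \<le> prob E * r ^ Suc n" .
    qed
    also have "\<dots> = real (card (K n)) * (prob E * r ^ Suc n)" by simp
    also have "\<dots> \<le> 3 ^ n * (prob E * r ^ Suc n)"
    proof (rule mult_right_mono)
      have "card (K n) \<le> card (contours n)"
        by (rule card_mono) (auto simp: K_def finite_contours)
      then have "card (K n) \<le> 3 ^ n" using card_contours le_trans by blast
      then have "real (card (K n)) \<le> real (3 ^ n)" by (simp only: of_nat_le_iff)
      then show "real (card (K n)) \<le> 3 ^ n" by simp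
    qed (use r in simp)
    finally show ?thesis by (simp add: power_mult_distrib algebra_simps)
  qed
  have sums: "(\<lambda>n. prob E * r * (3 * r) ^ n) sums (prob E * r * (1 / (1 - 3 * r)))"
    using r by (intro sums_mult geometric_sums) simp
  have summ: "summable (\<lambda>n. prob (B n))"
    by (rule summable_comparison_test_ev[OF _ sums_summable[OF sums]]) (use prob_B in simp)
  \<comment> \<open>Without percolation either the origin is closed, so that there is no cluster to
    surround, or a level is dry and a blocked contour exists.\<close>
  have "{\<omega>\<in>E. \<not> (\<forall>n. wet_level (op \<omega>) n \<noteq> {})} \<subseteq> {\<omega>\<in>E. \<forall>z\<in>{(0, 0)}. \<not> op \<omega> z} \<union> (\<Union>n. B n)"
  proof
    fix \<omega> assume "\<omega> \<in> {\<omega>\<in>E. \<not> (\<forall>n. wet_level (op \<omega>) n \<noteq> {})}"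
    then obtain n where "\<omega> \<in> E" "wet_level (op \<omega>) n = {}" by blast
    then show "\<omega> \<in> {\<omega>\<in>E. \<forall>z\<in>{(0, 0)}. \<not> op \<omega> z} \<union> (\<Union>n. B n)"
      using contour_of_dry_level[of "op \<omega>" n] by (simp add: B_def K_def) blast
  qed
  then have "prob {\<omega>\<in>E. \<not> (\<forall>n. wet_level (op \<omega>) n \<noteq> {})}
      \<le> prob ({\<omega>\<in>E. \<forall>z\<in>{(0, 0)}. \<not> op \<omega> z} \<union> (\<Union>n. B n))"
    using meas B by (intro finite_measure_mono) auto
  also have "\<dots> \<le> prob {\<omega>\<in>E. \<forall>z\<in>{(0, 0)}. \<not> op \<omega> z} + prob (\<Union>n. B n)"
    using meas B by (intro measure_Un_le) auto
  also have "prob {\<omega>\<in>E. \<forall>z\<in>{(0, 0)}. \<not> op \<omega> z} \<le> prob E * (r ^ 4) ^ card {(0::int, 0::int)}"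
    by (rule closed) auto
  also have "\<dots> \<le> prob E * r"
    using r by (intro mult_left_mono) (auto intro: power_decreasing[of 1 4 r, simplified])
  also have "prob (\<Union>n. B n) \<le> (\<Sum>n. prob (B n))"
    using summ B by (intro finite_measure_subadditive_countably) auto
  also have "\<dots> \<le> (\<Sum>n. prob E * r * (3 * r) ^ n)"
    by (rule suminf_le[OF prob_B summ sums_summable[OF sums]])
  also have "\<dots> = prob E * r * (1 / (1 - 3 * r))" using sums by (rule sums_unique[symmetric])
  finally show ?thesis by (simp add: algebra_simps)
qed

end

subsection \<open>Dynamics\<close>

text \<open>Linear functionals with coefficients in \<open>[-1, 1]\<close> grow by at most 1 per step, which bounds the speed.\<close>

definition height :: "('d::finite) site \<Rightarrow> 'd site \<Rightarrow> int" where
  "height a z = (\<Sum>l\<in>UNIV. a $ l * z $ l)"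

lemma height_add: "height a (y + z) = height a y + height a z"
  by (simp add: height_def algebra_simps sum.distrib)

lemma height_scale: "height a (m *s z) = m * height a z"
  by (simp add: height_def algebra_simps sum_distrib_left)

lemma height_axis: "height a (axis l v) = a $ l * v"
  by (simp add: height_def axis_def if_distrib[of "\<lambda>y. _ * y"] cong: if_cong)

lemma height_zero: "height a 0 = 0"
  by (simp add: height_def)

lemma height_step_le:
  assumes "v \<in> insert 0 unit_steps" "\<And>l. \<bar>a $ l\<bar> \<le> 1"
  shows "height a v \<le> 1"
proof -
  have "a $ l \<le> 1" "- (a $ l) \<le> 1" for l
    using assms(2)[of l] by (simp_all add: abs_le_iff)
  with assms(1) show ?thesis
    by (auto simp: unit_steps_def height_axis height_zero)
qed

definition cell_site :: "('d::finite) site \<Rightarrow> 'd site \<Rightarrow> 'd site \<Rightarrow> cell \<Rightarrow> 'd site" where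
  "cell_site y f g = (\<lambda>(a, b). y + (a *s f + b *s g))"

lemma cell_site_zero: "cell_site y f g (0, 0) = y"
  by (simp add: cell_site_def vec_eq_iff)

lemma cell_site_add:
  "cell_site y f g (z + (1, 0)) = cell_site y f g z + f"
  "cell_site y f g (z + (0, 1)) = cell_site y f g z + g"
  by (simp_all add: cell_site_def vec_eq_iff algebra_simps split: prod.split)

lemma height_cell_site:
  "height a (cell_site y f g z) = height a y + fst z * height a f + snd z * height a g"
  by (simp add: cell_site_def height_add height_scale split: prod.split)

lemma inj_cell_site:
  assumes "l \<noteq> l'" "v \<noteq> 0" "v' \<noteq> 0"
  shows "inj (cell_site y (axis l v) (axis l' v'))"
proof (rule injI)
  fix z z' assume "cell_site y (axis l v) (axis l' v') z = cell_site y (axis l v) (axis l' v') z'"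
  then have "cell_site y (axis l v) (axis l' v') z $ k = cell_site y (axis l v) (axis l' v') z' $ k" for k
    by simp
  from this[of l] this[of l'] assms show "z = z'"
    by (auto simp: cell_site_def axis_def prod_eq_iff case_prod_beta)
qed

text \<open>Here \<open>s\<close> is the time at which type \<open>i\<close> reaches
  \<open>y\<close>, and \<open>s + nat (fst z + snd z)\<close> is the arrival time at cell
  \<open>z\<close> at speed 1. Only particles initially at the site of the cell are inspected, so
  for injective \<open>cell_site y f g\<close> distinct cells involve distinct coordinates.\<close>

definition open_cell :: "nat \<Rightarrow> nat \<Rightarrow> ('d::finite) site \<Rightarrow> 'd site \<Rightarrow> 'd site \<Rightarrow> nat
    \<Rightarrow> 'd outcome \<Rightarrow> cell \<Rightarrow> bool" where
  "open_cell M s y f g i = (\<lambda>(\<eta>, \<xi>, u) z.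
     M \<le> \<eta> (cell_site y f g z) \<and>
     (\<forall>v\<in>{f, g}. \<exists>k<M. \<xi> ((cell_site y f g z, k), i, s + nat (fst z + snd z)) = v))"

section \<open>Deterministic properties of a single realisation\<close>

locale frog_run =
  fixes I :: "nat set" and x :: "nat \<Rightarrow> ('d::finite) site" and \<tau> :: "'d tie_rule"
    and \<eta> :: "'d site \<Rightarrow> nat" and \<xi> :: "'d particle \<times> nat \<times> nat \<Rightarrow> 'd site" and u :: real
  assumes tie: "tie_breaking \<tau>" and inj: "inj_on x I"
begin

definition conf :: "nat \<Rightarrow> 'd config" where
  "conf n = history I x \<tau> (\<eta>, \<xi>, u) n n"

text \<open>The existential hides the full history passed to the tie-breaking rule; what follows
  looks only at its entry at \<open>Suc n\<close>.\<close>

lemma conf_Suc: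
  "\<exists>h. h (Suc n) = move \<xi> n (conf n) \<and> conf (Suc n) = activate I x \<tau> \<eta> u (Suc n) h"
  by (rule exI[of _ "(history I x \<tau> (\<eta>, \<xi>, u) n)(Suc n := move \<xi> n (conf n))"])
    (simp add: conf_def Let_def)

lemma types_at_move:
  "types_at (move \<xi> n c) w = {i. \<exists>q z. c q = Some (z, i) \<and> w = z + \<xi> (q, i, n)}"
  by (auto simp: types_at_def move_def)

lemma conf_zero: "conf 0 q = Some (z, i) \<longleftrightarrow> i \<in> I \<and> z = x i \<and> q = (x i, 0)"
  using inj by (cases q) (auto simp: conf_def init_config_def the_inv_into_f_f)

lemma conf_move: "conf n q = Some (z, i) \<Longrightarrow> conf (Suc n) q = Some (z + \<xi> (q, i, n), i)"
  using conf_Suc[of n] by (cases q) (auto simp: activate_def move_def)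

lemma conf_newD:
  assumes "conf n q = None" "conf (Suc n) q = Some (w, i)"
  shows "fst q = w \<and> w \<notin> x ` I \<and> snd q < \<eta> w \<and>
    (\<exists>q' z. conf n q' = Some (z, i) \<and> w = z + \<xi> (q', i, n))"
proof -
  obtain h where h: "h (Suc n) = move \<xi> n (conf n)" "conf (Suc n) = activate I x \<tau> \<eta> u (Suc n) h"
    using conf_Suc by blast
  obtain z k where q: "q = (z, k)" by (cases q)
  let ?A = "types_at (h (Suc n)) z"
  have none: "h (Suc n) (z, k) = None"
    using assms(1) by (simp add: h(1) move_def q)
  have act: "z \<notin> x ` I \<and> k < \<eta> z \<and> ?A \<noteq> {}" "w = z"
    and i: "i = (if is_singleton ?A then the_elem ?A else \<tau> (Suc n) \<eta> h u (z, k))"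
    using assms(2) none by (auto simp: h(2) q activate_def Let_def split: if_split_asm)
  \<comment> \<open>The type given to a new particle is among the arriving ones: trivially if there
    is just one, by the condition on the rule otherwise.\<close>
  have "i \<in> ?A"
  proof (cases "is_singleton ?A")
    case True
    then have "?A = {i}" using i is_singleton_the_elem[of ?A] by presburger
    then show ?thesis by blast
  next
    case False
    then have "\<tau> (Suc n) \<eta> h u (z, k) \<in> ?A"
      using tie act unfolding tie_breaking_def by (metis fst_conv)
    then show ?thesis using i False by simp
  qed
  then show ?thesis using act q by (simp add: h(1) types_at_move)
qed

text \<open>When a single type arrives, the tie-breaking rule is not consulted.\<close>

lemma conf_activate:
  assumes "conf n (w, k) = None" "w \<notin> x ` I" "k < \<eta> w"
    and "\<And>j. (\<exists>q z. conf n q = Some (z, j) \<and> w = z + \<xi> (q, j, n)) \<longleftrightarrow> j = i"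
  shows "conf (Suc n) (w, k) = Some (w, i)"
proof -
  obtain h where h: "h (Suc n) = move \<xi> n (conf n)" "conf (Suc n) = activate I x \<tau> \<eta> u (Suc n) h"
    using conf_Suc by blast
  have "types_at (h (Suc n)) w = {i}"
    unfolding h(1) types_at_move using assms(4) by auto
  moreover have "h (Suc n) (w, k) = None" using assms(1) by (simp add: h(1) move_def)
  ultimately show ?thesis using assms(2,3) by (simp add: h(2) activate_def)
qed

text \<open>A newly activated particle also takes its type from an arrival at its site, so every
  occupied position can be traced back one step within its type. Speed bounds are obtained by
  iterating this.\<close>

lemma conf_predecessor:
  assumes "conf (Suc n) q = Some (w, i)"
  shows "\<exists>q' z. conf n q' = Some (z, i) \<and> w = z + \<xi> (q', i, n)"
proof (cases "conf n q")
  case None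
  then show ?thesis using conf_newD assms by blast
next
  case (Some a)
  then obtain z j where a: "conf n q = Some (z, j)" by (cases a) auto
  from conf_move[OF a] assms have "j = i" "w = z + \<xi> (q, i, n)" by auto
  with a show ?thesis by blast
qed

text \<open>Used in contrapositive form: as long as a site is unvisited, all its particles are
  dormant.\<close>

lemma conf_origin_visited:
  "conf n (w, k) \<noteq> None \<Longrightarrow> \<exists>m\<le>n. \<exists>q j. conf m q = Some (w, j)"
proof (induction n)
  case 0
  then show ?case using conf_zero by fastforce
next
  case (Suc n)
  show ?case
  proof (cases "conf n (w, k)")
    case None
    with Suc.prems show ?thesis using conf_newD[OF None] by fastforce
  next
    case (Some a)
    with Suc.IH show ?thesis using le_SucI by blast
  qed
qed

text \<open>The largest height reached by a type grows by at most 1 per time step, new particles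
  included, because each of them wakes where a particle of its type has arrived.\<close>

lemma conf_height_le:
  assumes step: "\<And>q j n. \<xi> (q, j, n) \<in> insert 0 unit_steps" and a: "\<And>l. \<bar>a $ l\<bar> \<le> 1"
    and start: "\<And>q z. conf s q = Some (z, j) \<Longrightarrow> height a z \<le> H"
  shows "conf (s + n) q = Some (z, j) \<Longrightarrow> height a z \<le> H + int n"
proof (induction n arbitrary: q z)
  case (Suc n)
  then obtain q' z' where "conf (s + n) q' = Some (z', j)" "z = z' + \<xi> (q', j, s + n)"
    using conf_predecessor[of "s + n" q z j] by auto
  with Suc.IH[of q' z'] height_step_le[OF step[of q' j "s + n"] a] show ?case
    by (simp add: height_add)
qed (use start in auto)

section \<open>Survival as an infinite set of particles that are ever active\<close>

abbreviation active :: "nat \<Rightarrow> nat \<Rightarrow> 'd particle set" where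
  "active n i \<equiv> active_particles I x \<tau> (\<eta>, \<xi>, u) n i"

lemma active_eq: "active n i = {q. \<exists>z. conf n q = Some (z, i)}"
  by (simp add: active_particles_def conf_def)

lemma active_mono: "n \<le> m \<Longrightarrow> active n i \<subseteq> active m i"
  by (rule lift_Suc_mono_le[of "\<lambda>n. active n i"]) (auto simp: active_eq dest: conf_move)

text \<open>In each step finitely many sites are entered and each holds finitely many particles.
  Finiteness matters because \<open>card\<close> of an infinite set is 0.\<close>

lemma finite_active: "finite (active n i)"
proof (induction n)
  case 0
  show ?case by (rule finite_subset[of _ "{(x i, 0)}"]) (auto simp: active_eq conf_zero)
next
  case (Suc n)
  let ?W = "(\<lambda>q. fst (the (conf n q)) + \<xi> (q, i, n)) ` active n i"
  have "active (Suc n) i \<subseteq> active n i \<union> (\<Union>w\<in>?W. (\<lambda>k. (w, k)) ` {..<\<eta> w})"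
  proof
    fix q assume "q \<in> active (Suc n) i"
    then obtain w where w: "conf (Suc n) q = Some (w, i)" by (auto simp: active_eq)
    show "q \<in> active n i \<union> (\<Union>w\<in>?W. (\<lambda>k. (w, k)) ` {..<\<eta> w})"
    proof (cases "conf n q")
      case None
      from conf_newD[OF None w] obtain q' z where
        q: "q = (w, snd q)" "snd q < \<eta> w" "conf n q' = Some (z, i)" "w = z + \<xi> (q', i, n)"
        by (metis prod.collapse)
      have "w \<in> ?W" using q(3,4) by (intro image_eqI[of _ _ q']) (auto simp: active_eq)
      then show ?thesis using q(1,2) by blast
    next
      case (Some a)
      then obtain z j where a: "conf n q = Some (z, j)" by (cases a) auto
      from conf_move[OF a] w have "j = i" by auto
      with a show ?thesis by (auto simp: active_eq)
    qed
  qed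
  then show ?case by (rule finite_subset) (use Suc in auto)
qed

text \<open>The active sets are finite and increasing in time, so their sizes diverge exactly when
  their union is infinite.\<close>

lemma survives_iff: "survives I x \<tau> (\<eta>, \<xi>, u) i \<longleftrightarrow> infinite (\<Union>n. active n i)"
proof
  assume s: "survives I x \<tau> (\<eta>, \<xi>, u) i"
  show "infinite (\<Union>n. active n i)"
  proof
    assume fin: "finite (\<Union>n. active n i)"
    from s obtain n where "card (active n i) > card (\<Union>n. active n i)"
      unfolding survives_def filterlim_at_top eventually_sequentially
      by (meson Suc_le_eq order_refl)
    moreover have "card (active n i) \<le> card (\<Union>n. active n i)"
      using fin by (intro card_mono) auto
    ultimately show False by simp
  qed
next
  assume inf: "infinite (\<Union>n. active n i)"
  show "survives I x \<tau> (\<eta>, \<xi>, u) i"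
    unfolding survives_def filterlim_at_top eventually_sequentially
  proof
    fix K
    obtain F where F: "F \<subseteq> (\<Union>n. active n i)" "finite F" "card F = K"
      using infinite_arbitrarily_large[OF inf] by blast
    then have "\<forall>q\<in>F. \<exists>n. q \<in> active n i" by blast
    then obtain N where N: "\<forall>q\<in>F. q \<in> active (N q) i" by metis
    have "K \<le> card (active n i)" if "Max (insert 0 (N ` F)) \<le> n" for n
    proof -
      have "q \<in> active n i" if "q \<in> F" for q
      proof -
        have "N q \<le> Max (insert 0 (N ` F))" using F(2) that by (intro Max_ge) auto
        then show ?thesis
          using active_mono[of "N q" n i] N that \<open>Max (insert 0 (N ` F)) \<le> n\<close> le_trans by blast
      qed
      then show ?thesis using F(3) card_mono[OF finite_active, of F n i] by blast
    qed
    then show "\<exists>m. \<forall>n\<ge>m. K \<le> card (active n i)" by blast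
  qed
qed

section \<open>Spread of a type along oriented open paths\<close>

lemma site_activates:
  assumes s: "0 < s" and arrival: "conf s q = Some (w, i)"
    and avoid: "\<And>n q j. n < s \<Longrightarrow> conf n q \<noteq> Some (w, j)"
    and own: "\<And>q j. conf s q = Some (w, j) \<Longrightarrow> j = i"
    and k: "k < \<eta> w"
  shows "conf s (w, k) = Some (w, i)"
proof -
  obtain n where n: "s = Suc n" using s gr0_conv_Suc by blast
  have "conf n (w, k) = None"
    using conf_origin_visited[of n w k] avoid unfolding n by (metis less_Suc_eq_le)
  \<comment> \<open>A starting site is occupied at time 0, which \<open>avoid\<close> excludes
    because \<open>s\<close> is positive.\<close>
  moreover have "w \<notin> x ` I"
    using avoid[of 0] s conf_zero by blast
  moreover have "(\<exists>q z. conf n q = Some (z, j) \<and> w = z + \<xi> (q, j, n)) \<longleftrightarrow> j = i" for j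
    using conf_predecessor[of n q w i] arrival conf_move own unfolding n by blast
  ultimately show ?thesis using conf_activate k unfolding n by blast
qed

text \<open>Induction along open paths: a wet cell activated at the earliest possible time sends a
  particle of type \<open>i\<close> in each direction at that very time. By \<open>avoid\<close> and
  \<open>own\<close> the next site is then visited for the first time, and by type \<open>i\<close>
  alone, so its particles all get type \<open>i\<close>.\<close>

lemma wet_spreads:
  fixes y f g i M s
  defines "site \<equiv> cell_site y f g"
  assumes s: "0 < s" and arrival: "conf s q = Some (y, i)"
    and avoid: "\<And>z n q j. 0 \<le> fst z \<Longrightarrow> 0 \<le> snd z \<Longrightarrow> n < s + nat (fst z + snd z) \<Longrightarrow>
      conf n q \<noteq> Some (site z, j)"
    and own: "\<And>z q j. 0 \<le> fst z \<Longrightarrow> 0 \<le> snd z \<Longrightarrow>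
      conf (s + nat (fst z + snd z)) q = Some (site z, j) \<Longrightarrow> j = i"
  shows "z \<in> wet_level (open_cell M s y f g i (\<eta>, \<xi>, u)) m \<Longrightarrow> k < \<eta> (site z) \<Longrightarrow>
    conf (s + m) (site z, k) = Some (site z, i)"
proof (induction m arbitrary: z k)
  case 0
  then have z: "z = (0, 0)" by simp
  then have y: "site z = y" by (simp add: site_def cell_site_zero)
  have "conf s (site z, k) = Some (site z, i)"
  proof (rule site_activates[OF s _ _ _ 0(2)])
    show "conf s q = Some (site z, i)" by (simp add: y arrival)
    show "conf n q \<noteq> Some (site z, j)" if "n < s" for n q j
      using avoid[of z n q j] that by (simp add: z)
    show "j = i" if "conf s q = Some (site z, j)" for q j
      using own[of z q j] that by (simp add: z)
  qed
  then show ?case by simp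
next
  case (Suc m)
  let ?op = "open_cell M s y f g i (\<eta>, \<xi>, u)"
  have z: "0 \<le> fst z" "0 \<le> snd z" "nat (fst z + snd z) = Suc m"
    using wet_levelD[OF Suc.prems(1)] by (blast, blast, metis nat_int)
  \<comment> \<open>The wet predecessor \<open>z'\<close> and the direction \<open>v\<close> in
    which one of its first \<open>M\<close> particles steps.\<close>
  from Suc.prems(1) obtain z' v where z': "z' \<in> wet_level ?op m" "v \<in> {f, g}" "site z = site z' + v"
    using cell_site_add(1)[of y f g "z - (1, 0)"] cell_site_add(2)[of y f g "z - (0, 1)"]
    unfolding site_def wet_level.simps diff_add_cancel by blast
  have z'm: "nat (fst z' + snd z') = m" using wet_levelD[OF z'(1)] by (metis nat_int)
  from wet_levelD[OF z'(1)] have "M \<le> \<eta> (site z')"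
    and "\<forall>v\<in>{f, g}. \<exists>k<M. \<xi> ((site z', k), i, s + m) = v"
    by (simp_all add: open_cell_def site_def z'm)
  with z'(2) obtain k' where k': "k' < M" "k' < \<eta> (site z')" "\<xi> ((site z', k'), i, s + m) = v"
    using less_le_trans by blast
  have "conf (s + Suc m) (site z', k') = Some (site z, i)"
    using conf_move[OF Suc.IH[OF z'(1) k'(2)]] by (simp add: z'(3) k'(3))
  then show ?case
  proof (rule site_activates[rotated])
    show "conf n q \<noteq> Some (site z, j)" if "n < s + Suc m" for n q j
      by (rule avoid[OF z(1,2)]) (use that in \<open>simp only: z(3)\<close>)
    show "j = i" if "conf (s + Suc m) q = Some (site z, j)" for q j
      by (rule own[OF z(1,2), of q]) (use that in \<open>simp only: z(3)\<close>)
  qed (use s Suc.prems(2) in simp_all)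
qed

text \<open>Wet cells of different levels are different sites, and each contributes its particle
  number 0, present because \<open>M\<close> is positive.\<close>

lemma percolation_survives:
  assumes s: "0 < s" and arrival: "conf s q = Some (y, i)" and M: "0 < M"
    and inj_site: "inj (cell_site y f g)"
    and avoid: "\<And>z n q j. 0 \<le> fst z \<Longrightarrow> 0 \<le> snd z \<Longrightarrow> n < s + nat (fst z + snd z) \<Longrightarrow>
      conf n q \<noteq> Some (cell_site y f g z, j)"
    and own: "\<And>z q j. 0 \<le> fst z \<Longrightarrow> 0 \<le> snd z \<Longrightarrow>
      conf (s + nat (fst z + snd z)) q = Some (cell_site y f g z, j) \<Longrightarrow> j = i"
    and wet: "\<And>n. wet_level (open_cell M s y f g i (\<eta>, \<xi>, u)) n \<noteq> {}"
  shows "survives I x \<tau> (\<eta>, \<xi>, u) i"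
proof -
  have "\<forall>n. \<exists>z. z \<in> wet_level (open_cell M s y f g i (\<eta>, \<xi>, u)) n"
    using wet by blast
  then obtain z where z: "\<And>n. z n \<in> wet_level (open_cell M s y f g i (\<eta>, \<xi>, u)) n"
    by metis
  have "inj (\<lambda>n. (cell_site y f g (z n), 0::nat))"
  proof (rule injI)
    fix n m assume "(cell_site y f g (z n), 0::nat) = (cell_site y f g (z m), 0)"
    then have "z n = z m" using injD[OF inj_site] by blast
    then show "n = m" using wet_levelD[OF z[of n]] wet_levelD[OF z[of m]] by (metis of_nat_eq_iff)
  qed
  moreover have "(cell_site y f g (z n), 0) \<in> active (s + n) i" for n
  proof -
    have "0 < \<eta> (cell_site y f g (z n))"
      using conjunct1[OF wet_levelD[OF z[of n]]] M by (simp add: open_cell_def)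
    have "conf (s + n) (cell_site y f g (z n), 0) = Some (cell_site y f g (z n), i)"
      by (rule wet_spreads[OF s arrival _ _ z \<open>0 < \<eta> _\<close>]) (fact avoid, fact own)
    then show ?thesis unfolding active_eq by blast
  qed
  then have "range (\<lambda>n. (cell_site y f g (z n), 0)) \<subseteq> (\<Union>n. active n i)" by blast
  ultimately show ?thesis
    unfolding survives_iff by (metis finite_subset range_inj_infinite)
qed

end

subsection \<open>The law of the steps and measurability\<close>

lemma unit_steps_eq: "unit_steps = range (\<lambda>j. axis j 1) \<union> range (\<lambda>j. axis j (- 1))"
  by (auto simp: unit_steps_def)

lemma finite_unit_steps: "finite unit_steps"
  by (simp add: unit_steps_eq)

lemma card_unit_steps_le: "card (unit_steps :: ('d::finite) site set) \<le> 2 * CARD('d)"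
proof -
  have "card (unit_steps :: 'd site set)
      \<le> card (range (\<lambda>j :: 'd. axis j (1::int))) + card (range (\<lambda>j :: 'd. axis j (- 1 :: int)))"
    unfolding unit_steps_eq by (rule card_Un_le)
  also have "\<dots> \<le> CARD('d) + CARD('d)"
    by (intro add_mono card_image_le) simp_all
  finally show ?thesis by simp
qed

lemma set_lazy_step: "set_pmf (lazy_step r) \<subseteq> insert 0 unit_steps"
proof -
  have "set_pmf (pmf_of_set unit_steps) = (unit_steps :: 'a site set)"
    by (rule set_pmf_of_set) (simp_all add: unit_steps_eq)
  then show ?thesis
    by (auto simp: lazy_step_def split: if_splits)
qed

lemma pmf_lazy_step_ge:
  fixes v :: "('d::finite) site"
  assumes r: "0 < r" "r \<le> 1" and v: "v \<in> unit_steps"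
  shows "r / (2 * CARD('d)) \<le> pmf (lazy_step r) v"
proof -
  have c: "0 < card (unit_steps :: 'd site set)"
    using v finite_unit_steps by (auto simp: card_gt_0_iff)
  have "r / (2 * CARD('d)) \<le> r * (1 / card (unit_steps :: 'd site set))"
    using r c card_unit_steps_le[where 'd='d] by (simp add: frac_le mult.commute)
  also have "\<dots> = r * pmf (pmf_of_set unit_steps) v"
    using v finite_unit_steps by (subst pmf_of_set) auto
  also have "\<dots> \<le> r * pmf (pmf_of_set unit_steps) v + (1 - r) * pmf (return_pmf 0) v"
    using r by simp
  also have "\<dots> = pmf (lazy_step r) v"
    using r by (simp add: lazy_step_def pmf_bind)
  finally show ?thesis .
qed

lemma prob_lazy_step_avoid:
  fixes v :: "('d::finite) site"
  assumes r: "0 < r" "r \<le> 1" and v: "v \<in> unit_steps"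
  shows "measure_pmf.prob (lazy_step r) (- {v}) \<le> 1 - r / (2 * CARD('d))"
proof -
  have "measure_pmf.prob (lazy_step r) (- {v}) = 1 - pmf (lazy_step r) v"
    using measure_pmf.prob_compl[of "{v}" "lazy_step r"] by (simp add: Compl_eq_Diff_UNIV measure_pmf_single)
  then show ?thesis using pmf_lazy_step_ge[OF assms] by simp
qed

text \<open>A \<sigma>-algebra common to all laws \<open>frog_measure \<mu> p \<nu>\<close>, so that
  measurability can be proved independently of the parameters.\<close>

definition outcome_algebra :: "('d::finite) outcome measure" where
  "outcome_algebra = (\<Pi>\<^sub>M z\<in>UNIV. count_space UNIV) \<Otimes>\<^sub>M ((\<Pi>\<^sub>M b\<in>UNIV. count_space UNIV) \<Otimes>\<^sub>M borel)"

definition history_algebra :: "(nat \<Rightarrow> ('d::finite) config) measure" where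
  "history_algebra = (\<Pi>\<^sub>M m\<in>UNIV. \<Pi>\<^sub>M q\<in>UNIV. count_space UNIV)"

lemma sets_frog_measure:
  assumes "sets \<nu> = sets borel"
  shows "sets (frog_measure \<mu> p \<nu>) = sets outcome_algebra"
  unfolding frog_measure_def outcome_algebra_def
  by (intro sets_pair_measure_cong sets_PiM_cong) (auto simp: assms)

lemma measurable_outcome [measurable]:
  "(\<lambda>\<omega>. fst \<omega> z) \<in> outcome_algebra \<rightarrow>\<^sub>M count_space UNIV"
  "(\<lambda>\<omega>. fst (snd \<omega>) b) \<in> outcome_algebra \<rightarrow>\<^sub>M count_space UNIV"
  unfolding outcome_algebra_def by measurable

lemma measurable_history_algebraI:
  assumes "\<And>m q. (\<lambda>\<omega>. h \<omega> m q) \<in> M \<rightarrow>\<^sub>M count_space UNIV"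
  shows "h \<in> M \<rightarrow>\<^sub>M history_algebra"
  unfolding history_algebra_def
  by (rule measurable_PiM_single', rule measurable_PiM_single') (auto simp: assms space_PiM)

lemma measurable_history_algebraD:
  assumes "h \<in> M \<rightarrow>\<^sub>M history_algebra"
  shows "(\<lambda>\<omega>. h \<omega> m q) \<in> M \<rightarrow>\<^sub>M count_space UNIV"
proof -
  have "(\<lambda>\<omega>. h \<omega> m) \<in> M \<rightarrow>\<^sub>M (\<Pi>\<^sub>M q\<in>UNIV. count_space UNIV)"
    by (rule measurable_compose[OF assms[unfolded history_algebra_def]]) simp
  then show ?thesis
    by (rule measurable_compose) simp
qed

lemma measurable_move:
  assumes "(\<lambda>\<omega>. c \<omega> q) \<in> outcome_algebra \<rightarrow>\<^sub>M count_space UNIV"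
  shows "(\<lambda>\<omega>. move (fst (snd \<omega>)) n (c \<omega>) q) \<in> outcome_algebra \<rightarrow>\<^sub>M count_space UNIV"
  unfolding move_def
proof (rule measurable_compose_countable[OF _ assms])
  \<comment> \<open>The displacement used depends on the random type in \<open>c\<close>; as
    configurations at a label take countably many values, this value may be frozen.\<close>
  fix a :: "('a site \<times> nat) option"
  show "(\<lambda>\<omega>. map_option (\<lambda>(z, i). (z + fst (snd \<omega>) (q, i, n), i)) a)
      \<in> outcome_algebra \<rightarrow>\<^sub>M count_space UNIV"
  proof (cases a)
    case (Some b)
    then show ?thesis
      using measurable_compose[OF measurable_outcome(2)[of "(q, snd b, n)"],
          of "\<lambda>v. Some (fst b + v, snd b)" "count_space UNIV"]
      by (simp add: case_prod_beta)
  qed simp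
qed

text \<open>Rewrites uniqueness and the unique element by countable quantifiers and
  \<open>LEAST\<close>, for which measurability is automatic.\<close>

lemma is_singleton_Least:
  fixes A :: "nat set"
  shows "is_singleton A \<longleftrightarrow> (\<exists>i. i \<in> A \<and> (\<forall>j. j \<in> A \<longrightarrow> j = i))"
    and "is_singleton A \<Longrightarrow> the_elem A = (LEAST i. i \<in> A)"
  by (auto simp: is_singleton_def intro!: Least_equality[symmetric])

lemma measurable_history:
  assumes tie: "tie_breaking \<tau>"
  shows "(\<lambda>\<omega>. history I x \<tau> \<omega> n) \<in> outcome_algebra \<rightarrow>\<^sub>M history_algebra"
proof (induction n)
  case 0
  then show ?case by (intro measurable_history_algebraI) simp
next
  case (Suc n)
  note IH = measurable_history_algebraD[OF Suc]
  define h where "h \<omega> = (history I x \<tau> \<omega> n)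
      (Suc n := move (fst (snd \<omega>)) n (history I x \<tau> \<omega> n n))" for \<omega>
  have hm: "h \<in> outcome_algebra \<rightarrow>\<^sub>M history_algebra"
  proof (rule measurable_history_algebraI)
    fix m q
    show "(\<lambda>\<omega>. h \<omega> m q) \<in> outcome_algebra \<rightarrow>\<^sub>M count_space UNIV"
      using IH measurable_move[OF IH] by (cases "m = Suc n") (simp_all add: h_def)
  qed
  note [measurable] = measurable_history_algebraD[OF hm]
  have rule_m: "(\<lambda>\<omega>. \<tau> (Suc n) (fst \<omega>) (h \<omega>) (snd (snd \<omega>)) q)
      \<in> outcome_algebra \<rightarrow>\<^sub>M count_space UNIV" for q
  proof -
    have "(\<lambda>\<omega>. (fst \<omega>, h \<omega>, snd (snd \<omega>))) \<in> outcome_algebra \<rightarrow>\<^sub>M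
        (\<Pi>\<^sub>M z\<in>UNIV. count_space UNIV) \<Otimes>\<^sub>M (history_algebra \<Otimes>\<^sub>M borel)"
      using hm unfolding outcome_algebra_def by measurable
    moreover have "(\<lambda>(\<eta>, h, u). \<tau> (Suc n) \<eta> h u q) \<in>
        (\<Pi>\<^sub>M z\<in>UNIV. count_space UNIV) \<Otimes>\<^sub>M (history_algebra \<Otimes>\<^sub>M borel) \<rightarrow>\<^sub>M count_space UNIV"
      using tie unfolding tie_breaking_def history_algebra_def by blast
    ultimately have "(\<lambda>\<omega>. (\<lambda>(\<eta>, h, u). \<tau> (Suc n) \<eta> h u q) (fst \<omega>, h \<omega>, snd (snd \<omega>)))
        \<in> outcome_algebra \<rightarrow>\<^sub>M count_space UNIV"
      by (rule measurable_compose)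
    then show ?thesis by simp
  qed
  show ?case
  proof (rule measurable_history_algebraI)
    fix m and q :: "'a particle"
    obtain z k where q: "q = (z, k)" by (cases q)
    define P where "P \<omega> i \<longleftrightarrow> (\<exists>q. h \<omega> (Suc n) q = Some (z, i))" for \<omega> i
    have P: "types_at (h \<omega> (Suc n)) z = {i. P \<omega> i}" for \<omega>
      by (simp add: P_def types_at_def)
    have [measurable]: "Measurable.pred outcome_algebra (\<lambda>\<omega>. P \<omega> i)" for i
      unfolding P_def by measurable
    \<comment> \<open>The type that \<open>q\<close> would receive, made total: if nothing arrives,
      the value is discarded by the guard \<open>\<exists>i. P \<omega> i\<close> below.\<close>
    define t where "t \<omega> = (if \<exists>i. P \<omega> i \<and> (\<forall>j. P \<omega> j \<longrightarrow> j = i) then (LEAST i. P \<omega> i)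
        else \<tau> (Suc n) (fst \<omega>) (h \<omega>) (snd (snd \<omega>)) q)" for \<omega>
    have [measurable]: "t \<in> outcome_algebra \<rightarrow>\<^sub>M count_space UNIV"
      unfolding t_def using rule_m[of q] by measurable
    have t: "(\<lambda>\<omega>. Some (z, t \<omega>)) \<in> outcome_algebra \<rightarrow>\<^sub>M count_space UNIV"
      by (rule measurable_compose[of t _ "count_space UNIV"]) simp_all
    have "history I x \<tau> \<omega> (Suc n) (Suc n) q =
        (if h \<omega> (Suc n) q \<noteq> None then h \<omega> (Suc n) q
         else if z \<notin> x ` I \<and> k < fst \<omega> z \<and> (\<exists>i. P \<omega> i) then Some (z, t \<omega>) else None)" for \<omega>
    proof -
      have act: "history I x \<tau> \<omega> (Suc n) (Suc n) =
          activate I x \<tau> (fst \<omega>) (snd (snd \<omega>)) (Suc n) (h \<omega>)"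
        by (cases \<omega>) (simp add: Let_def h_def)
      show ?thesis
        unfolding act q activate_def prod.case Let_def P t_def
        using is_singleton_Least[of "{i. P \<omega> i}"]
        by (cases "h \<omega> (Suc n) (z, k)") (simp_all, blast)
    qed
    moreover have "(\<lambda>\<omega>. if h \<omega> (Suc n) q \<noteq> None then h \<omega> (Suc n) q
         else if z \<notin> x ` I \<and> k < fst \<omega> z \<and> (\<exists>i. P \<omega> i) then Some (z, t \<omega>) else None)
        \<in> outcome_algebra \<rightarrow>\<^sub>M count_space UNIV"
      using t by measurable
    moreover have "history I x \<tau> \<omega> (Suc n) m q = h \<omega> m q" if "m \<noteq> Suc n" for \<omega>
      using that by (cases \<omega>) (simp add: Let_def h_def)
    ultimately show "(\<lambda>\<omega>. history I x \<tau> \<omega> (Suc n) m q) \<in> outcome_algebra \<rightarrow>\<^sub>M count_space UNIV"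
      by (cases "m = Suc n") simp_all
  qed
qed

text \<open>Enumerating particles by \<open>to_nat\<close> turns infinitude into unboundedness, a
  statement with countable quantifiers only.\<close>

lemma survives_measurable:
  assumes tie: "tie_breaking \<tau>" and inj: "inj_on x I"
  shows "Measurable.pred outcome_algebra (\<lambda>\<omega>. survives I x \<tau> \<omega> i)"
proof -
  note [measurable] = measurable_history_algebraD[OF measurable_history[OF tie]]
  have "survives I x \<tau> \<omega> i \<longleftrightarrow>
      (\<forall>m. \<exists>q n z. m \<le> to_nat q \<and> history I x \<tau> \<omega> n n q = Some (z, i))" for \<omega>
  proof -
    obtain \<eta> \<xi> u where \<omega>: "\<omega> = (\<eta>, \<xi>, u)" by (cases \<omega>)
    interpret frog_run I x \<tau> \<eta> \<xi> u using tie inj by unfold_locales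
    have "survives I x \<tau> \<omega> i \<longleftrightarrow> infinite (to_nat ` (\<Union>n. active n i))"
      by (simp add: \<omega> survives_iff finite_image_iff)
    also have "\<dots> \<longleftrightarrow> (\<forall>m. \<exists>q n z. m \<le> to_nat q \<and> history I x \<tau> \<omega> n n q = Some (z, i))"
      unfolding infinite_nat_iff_unbounded_le \<omega> active_eq conf_def by blast
    finally show ?thesis .
  qed
  then show ?thesis by simp
qed

subsection \<open>Cylinder events\<close>

definition cylinder :: "('d::finite) site set \<Rightarrow> ('d site \<Rightarrow> nat set)
    \<Rightarrow> ('d particle \<times> nat \<times> nat) set \<Rightarrow> ('d particle \<times> nat \<times> nat \<Rightarrow> 'd site set) \<Rightarrow> 'd outcome set" where
  "cylinder A F B G = {\<omega>. (\<forall>z\<in>A. fst \<omega> z \<in> F z) \<and> (\<forall>b\<in>B. fst (snd \<omega>) b \<in> G b)}"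

lemma space_outcome_algebra: "space outcome_algebra = UNIV"
  by (simp add: outcome_algebra_def space_pair_measure space_PiM)

locale frog_law =
  fixes \<mu> :: "nat pmf" and p :: "nat \<Rightarrow> real" and \<nu> :: "real measure"
    and N :: "('d::finite) outcome measure"
  assumes prob_\<nu>: "prob_space \<nu>" and sets_\<nu>: "sets \<nu> = sets borel"
    and N_def: "N = frog_measure \<mu> p \<nu>"
begin

abbreviation step_measure :: "('d particle \<times> nat \<times> nat \<Rightarrow> 'd site) measure" where
  "step_measure \<equiv> \<Pi>\<^sub>M (q, i, n)\<in>UNIV. measure_pmf (lazy_step (p i))"

lemma prob_step_measure: "prob_space step_measure"
  by (intro prob_space_PiM) (auto simp: measure_pmf.prob_space_axioms split: prod.split)

lemma sets_N [measurable_cong]: "sets N = sets outcome_algebra"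
  unfolding N_def using sets_\<nu> by (rule sets_frog_measure)

lemma space_N: "space N = UNIV"
  using sets_eq_imp_space_eq[OF sets_N] by (simp add: space_outcome_algebra)

lemma emeasure_product_Collect:
  assumes "\<And>i. prob_space (P i)" "\<And>i. sets (P i) = UNIV" "finite J"
  shows "{x. \<forall>i\<in>J. x i \<in> X i} \<in> sets (Pi\<^sub>M UNIV P)"
    and "emeasure (Pi\<^sub>M UNIV P) {x. \<forall>i\<in>J. x i \<in> X i} = (\<Prod>i\<in>J. emeasure (P i) (X i))"
proof -
  have "space (P i) = UNIV" for i
    using assms(2)[of i] sets.sets_into_space[of UNIV "P i"] by auto
  then have eq: "{x. \<forall>i\<in>J. x i \<in> X i} = prod_emb UNIV P J (Pi\<^sub>E J X)"
    by (auto simp: prod_emb_def PiE_iff)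
  show "{x. \<forall>i\<in>J. x i \<in> X i} \<in> sets (Pi\<^sub>M UNIV P)"
    unfolding eq using assms by (intro sets_PiM_I) auto
  show "emeasure (Pi\<^sub>M UNIV P) {x. \<forall>i\<in>J. x i \<in> X i} = (\<Prod>i\<in>J. emeasure (P i) (X i))"
    unfolding eq using assms by (intro emeasure_PiM_emb) auto
qed

sublocale prob_space N
  unfolding N_def frog_measure_def
  by (intro prob_space_pair prob_\<nu> prob_step_measure prob_space_PiM measure_pmf.prob_space_axioms)

lemma cylinder_sets: "finite A \<Longrightarrow> finite B \<Longrightarrow> cylinder A F B G \<in> events"
proof -
  assume [simp]: "finite A" "finite B"
  have "cylinder A F B G = {\<omega>\<in>space N. (\<forall>z\<in>A. fst \<omega> z \<in> F z) \<and> (\<forall>b\<in>B. fst (snd \<omega>) b \<in> G b)}"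
    by (simp add: cylinder_def space_N)
  also have "\<dots> \<in> events" by measurable
  finally show ?thesis .
qed

lemma prob_cylinder:
  assumes "finite A" "finite B"
  shows "prob (cylinder A F B G) = (\<Prod>z\<in>A. measure_pmf.prob \<mu> (F z)) *
    (\<Prod>b\<in>B. measure_pmf.prob (lazy_step (p (fst (snd b)))) (G b))"
proof -
  interpret S: prob_space step_measure by (rule prob_step_measure)
  interpret U: prob_space \<nu> by (rule prob_\<nu>)
  interpret SU: prob_space "step_measure \<Otimes>\<^sub>M \<nu>"
    by (intro prob_space_pair prob_step_measure prob_\<nu>)
  have U: "space \<nu> = UNIV" using sets_eq_imp_space_eq[OF sets_\<nu>] by simp
  let ?X = "{\<eta>. \<forall>z\<in>A. \<eta> z \<in> F z}" and ?Y = "{\<xi>. \<forall>b\<in>B. \<xi> b \<in> G b}"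
  let ?P = "\<lambda>b. case b of (q, i, n) \<Rightarrow> measure_pmf (lazy_step (p i))"
  have P: "prob_space (?P b)" "sets (?P b) = UNIV" for b :: "'d particle \<times> nat \<times> nat"
    by (auto simp: measure_pmf.prob_space_axioms split: prod.split)
  note X = emeasure_product_Collect[of "\<lambda>_. measure_pmf \<mu>", OF measure_pmf.prob_space_axioms sets_measure_pmf \<open>finite A\<close>]
  note Y = emeasure_product_Collect[of ?P, OF P \<open>finite B\<close>]
  have "cylinder A F B G = ?X \<times> (?Y \<times> space \<nu>)"
    by (auto simp: cylinder_def U)
  then have "emeasure N (cylinder A F B G) =
      emeasure (\<Pi>\<^sub>M z\<in>UNIV. measure_pmf \<mu>) ?X * emeasure (step_measure \<Otimes>\<^sub>M \<nu>) (?Y \<times> space \<nu>)"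
    unfolding N_def frog_measure_def
    using X(1)[of F] Y(1)[of G]
    by (simp only:) (intro SU.emeasure_pair_measure_Times pair_measureI sets.top)
  also have "emeasure (step_measure \<Otimes>\<^sub>M \<nu>) (?Y \<times> space \<nu>) = emeasure step_measure ?Y"
    by (subst U.emeasure_pair_measure_Times[OF Y(1)[of G] sets.top]) (simp add: U.emeasure_space_1)
  also have "emeasure step_measure ?Y = (\<Prod>b\<in>B. emeasure (lazy_step (p (fst (snd b)))) (G b))"
    unfolding Y(2) by (intro prod.cong) (auto split: prod.split)
  finally have "ennreal (prob (cylinder A F B G)) = ennreal ((\<Prod>z\<in>A. measure_pmf.prob \<mu> (F z)) *
    (\<Prod>b\<in>B. measure_pmf.prob (lazy_step (p (fst (snd b)))) (G b)))"
    unfolding X(2) emeasure_eq_measure measure_pmf.emeasure_eq_measure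
    by (simp add: prod_ennreal ennreal_mult prod_nonneg)
  then show ?thesis by (simp add: prod_nonneg)
qed

text \<open>There are countably many labels, so one null set serves all of them; off it the speed
  bounds apply.\<close>

lemma AE_steps: "AE \<omega> in N. \<forall>b. fst (snd \<omega>) b \<in> insert 0 unit_steps"
  unfolding AE_all_countable
proof
  fix b :: "'d particle \<times> nat \<times> nat"
  let ?C = "cylinder {} (\<lambda>_. UNIV) {b} (\<lambda>_. insert 0 unit_steps)"
  have "measure_pmf.prob (lazy_step (p (fst (snd b)))) (insert 0 unit_steps) = 1"
    using measure_pmf.prob_eq_1[of "insert 0 unit_steps" "lazy_step (p (fst (snd b)))"] set_lazy_step
    by (auto simp: AE_measure_pmf_iff)
  then have "prob ?C = 1" by (subst prob_cylinder) simp_all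
  then have "AE \<omega> in N. \<omega> \<in> ?C" by (rule AE_prob_1)
  then show "AE \<omega> in N. fst (snd \<omega>) b \<in> insert 0 unit_steps" by (simp add: cylinder_def)
qed

lemma open_cell_sets: "{\<omega>\<in>space N. open_cell M s y f g i \<omega> z} \<in> events"
  unfolding open_cell_def case_prod_beta by measurable

text \<open>
  A cell is closed for one of three reasons: too few particles, or one of the two directions is
  missed. Once a reason is chosen for each cell of \<open>S\<close>, the event is a cylinder.
\<close>

lemma prob_closed_cells_le:
  fixes A :: "'d site set" and f g y :: "'d site" and c :: real
  defines "site \<equiv> cell_site y f g"
  assumes fin: "finite A" "finite B"
    and early: "\<And>b. b \<in> B \<Longrightarrow> snd (snd b) < s"
    and off: "\<And>z. 0 \<le> fst z \<Longrightarrow> 0 \<le> snd z \<Longrightarrow> site z \<notin> A"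
    and inj: "inj site"
    and few: "measure_pmf.prob \<mu> {..<M} \<le> c"
    and miss: "\<And>v. v \<in> {f, g} \<Longrightarrow> measure_pmf.prob (lazy_step (p i)) (- {v}) ^ M \<le> c"
    and S: "finite S" "S \<subseteq> {z. 0 \<le> fst z \<and> 0 \<le> snd z}"
  shows "prob {\<omega>\<in>cylinder A F B G. \<forall>z\<in>S. \<not> open_cell M s y f g i \<omega> z}
    \<le> prob (cylinder A F B G) * (3 * c) ^ card S"
proof -
  have c: "0 \<le> c" using few measure_nonneg order_trans by blast
  define lab where "lab z k = ((site z, k), i, s + nat (fst z + snd z))" for z :: cell and k :: nat
  \<comment> \<open>\<open>None\<close> stands for too few particles, \<open>Some v\<close> for the
    missed direction \<open>v\<close>.\<close>
  define R where "R = insert None (Some ` {f, g})"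
  define bad where "bad z r \<omega> = (case r of None \<Rightarrow> fst \<omega> (site z) < M
    | Some v \<Rightarrow> \<forall>k<M. fst (snd \<omega>) (lab z k) \<noteq> v)" for z r and \<omega> :: "'d outcome"
  define W where "W \<rho> = {z\<in>S. \<rho> z = None}" for \<rho> :: "cell \<Rightarrow> 'd site option"
  define V where "V \<rho> = (S - W \<rho>) \<times> {..<M}" for \<rho> :: "cell \<Rightarrow> 'd site option"
  \<comment> \<open>The sites of \<open>W \<rho>\<close> avoid \<open>A\<close> by
    \<open>off\<close>, and the added labels carry times at least \<open>s\<close> while those in
    \<open>B\<close> are earlier. The added constraints thus concern new coordinates. The cell of a
    label is recovered by \<open>the_inv site\<close>.\<close>
  define C where "C \<rho> = cylinder (A \<union> site ` W \<rho>) (\<lambda>z. if z \<in> A then F z else {..<M})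
      (B \<union> case_prod lab ` V \<rho>)
      (\<lambda>b. if b \<in> B then G b else - {the (\<rho> (the_inv site (fst (fst b))))})" for \<rho>
  have fin': "finite (W \<rho>)" "finite (V \<rho>)" for \<rho>
    using S(1) by (simp_all add: W_def V_def)
  have labB: "lab z k \<notin> B" for z k
    using early[of "lab z k"] by (auto simp: lab_def)
  have siteA: "site ` W \<rho> \<inter> A = {}" for \<rho>
    using off S(2) by (auto simp: W_def)
  have inj_lab: "inj_on (case_prod lab) T" for T
    using inj by (auto simp: lab_def inj_on_def)
  have sub: "{\<omega>\<in>cylinder A F B G. \<forall>z\<in>S. \<not> open_cell M s y f g i \<omega> z} \<subseteq> (\<Union>\<rho>\<in>S \<rightarrow>\<^sub>E R. C \<rho>)"
  proof
    fix \<omega> assume \<omega>: "\<omega> \<in> {\<omega>\<in>cylinder A F B G. \<forall>z\<in>S. \<not> open_cell M s y f g i \<omega> z}"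
    have "\<exists>r\<in>R. bad z r \<omega>" if "z \<in> S" for z
    proof -
      have "\<not> open_cell M s y f g i \<omega> z" using \<omega> that by blast
      then have "fst \<omega> (site z) < M \<or> (\<exists>v\<in>{f, g}. \<forall>k<M. fst (snd \<omega>) (lab z k) \<noteq> v)"
        by (simp add: open_cell_def case_prod_beta lab_def site_def not_le)
      then show ?thesis unfolding R_def bad_def by (elim disjE) auto
    qed
    then obtain \<rho> where \<rho>: "\<And>z. z \<in> S \<Longrightarrow> \<rho> z \<in> R \<and> bad z (\<rho> z) \<omega>" by metis
    define \<sigma> where "\<sigma> = restrict \<rho> S"
    have \<sigma>: "\<sigma> \<in> S \<rightarrow>\<^sub>E R" "\<And>z. z \<in> S \<Longrightarrow> bad z (\<sigma> z) \<omega>"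
      using \<rho> by (auto simp: \<sigma>_def)
    have "fst \<omega> z \<in> (if z \<in> A then F z else {..<M})" if "z \<in> A \<union> site ` W \<sigma>" for z
      using that \<omega> \<sigma>(2) by (fastforce simp: cylinder_def W_def bad_def)
    moreover have "fst (snd \<omega>) b \<in> (if b \<in> B then G b else - {the (\<sigma> (the_inv site (fst (fst b))))})"
      if b: "b \<in> B \<union> case_prod lab ` V \<sigma>" for b
    proof (cases "b \<in> B")
      case True
      then show ?thesis using \<omega> by (simp add: cylinder_def)
    next
      case False
      with b obtain w where "w \<in> V \<sigma>" "b = case_prod lab w" by blast
      then obtain z k where zk: "b = lab z k" "z \<in> S" "\<sigma> z \<noteq> None" "k < M"
        by (cases w) (simp add: V_def W_def)
      have "the_inv site (fst (fst b)) = z"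
        using the_inv_f_f[OF inj] by (simp add: zk(1) lab_def)
      then show ?thesis using False \<sigma>(2)[OF zk(2)] zk(3,4) by (auto simp: bad_def zk(1))
    qed
    ultimately have "\<omega> \<in> C \<sigma>" by (simp add: C_def cylinder_def)
    with \<sigma>(1) show "\<omega> \<in> (\<Union>\<rho>\<in>S \<rightarrow>\<^sub>E R. C \<rho>)" by blast
  qed
  \<comment> \<open>Each cell of \<open>S\<close> contributes a factor of at most \<open>c\<close>:
    one factor for the lack of particles, or \<open>M\<close> independent missed steps.\<close>
  have C_le: "prob (C \<rho>) \<le> prob (cylinder A F B G) * c ^ card S" if \<rho>: "\<rho> \<in> S \<rightarrow>\<^sub>E R" for \<rho>
  proof -
    let ?a = "\<Prod>z\<in>A. measure_pmf.prob \<mu> (F z)"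
    let ?b = "\<Prod>b\<in>B. measure_pmf.prob (lazy_step (p (fst (snd b)))) (G b)"
    have "(\<Prod>z\<in>A \<union> site ` W \<rho>. measure_pmf.prob \<mu> (if z \<in> A then F z else {..<M}))
        = (\<Prod>z\<in>A. measure_pmf.prob \<mu> (if z \<in> A then F z else {..<M})) *
          (\<Prod>z\<in>site ` W \<rho>. measure_pmf.prob \<mu> (if z \<in> A then F z else {..<M}))"
      using fin fin' siteA[of \<rho>] by (intro prod.union_disjoint) auto
    also have "(\<Prod>z\<in>A. measure_pmf.prob \<mu> (if z \<in> A then F z else {..<M})) = ?a"
      by (intro prod.cong) auto
    also have "(\<Prod>z\<in>site ` W \<rho>. measure_pmf.prob \<mu> (if z \<in> A then F z else {..<M}))
        = (\<Prod>z\<in>site ` W \<rho>. measure_pmf.prob \<mu> {..<M})"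
      using siteA[of \<rho>] by (intro prod.cong) auto
    also have "(\<Prod>z\<in>site ` W \<rho>. measure_pmf.prob \<mu> {..<M}) = measure_pmf.prob \<mu> {..<M} ^ card (W \<rho>)"
      using card_image[OF inj_on_subset[OF inj subset_UNIV], of "W \<rho>"] by simp
    finally have 1: "(\<Prod>z\<in>A \<union> site ` W \<rho>. measure_pmf.prob \<mu> (if z \<in> A then F z else {..<M}))
        = ?a * measure_pmf.prob \<mu> {..<M} ^ card (W \<rho>)" .
    let ?G = "\<lambda>b. if b \<in> B then G b else - {the (\<rho> (the_inv site (fst (fst b))))}"
    have "(\<Prod>b\<in>B \<union> case_prod lab ` V \<rho>. measure_pmf.prob (lazy_step (p (fst (snd b)))) (?G b))
        = (\<Prod>b\<in>B. measure_pmf.prob (lazy_step (p (fst (snd b)))) (?G b)) *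
          (\<Prod>b\<in>case_prod lab ` V \<rho>. measure_pmf.prob (lazy_step (p (fst (snd b)))) (?G b))"
      using fin fin' labB by (intro prod.union_disjoint) auto
    also have "(\<Prod>b\<in>B. measure_pmf.prob (lazy_step (p (fst (snd b)))) (?G b)) = ?b"
      by (intro prod.cong) auto
    also have "(\<Prod>b\<in>case_prod lab ` V \<rho>. measure_pmf.prob (lazy_step (p (fst (snd b)))) (?G b))
        = (\<Prod>(z, k)\<in>V \<rho>. measure_pmf.prob (lazy_step (p i)) (- {the (\<rho> z)}))"
      using labB the_inv_f_f[OF inj]
      by (subst prod.reindex[OF inj_lab]) (auto intro!: prod.cong simp: lab_def)
    also have "\<dots> = (\<Prod>z\<in>S - W \<rho>. measure_pmf.prob (lazy_step (p i)) (- {the (\<rho> z)}) ^ M)"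
      unfolding V_def by (subst prod.cartesian_product[symmetric]) simp
    finally have 2: "(\<Prod>b\<in>B \<union> case_prod lab ` V \<rho>. measure_pmf.prob (lazy_step (p (fst (snd b)))) (?G b))
        = ?b * (\<Prod>z\<in>S - W \<rho>. measure_pmf.prob (lazy_step (p i)) (- {the (\<rho> z)}) ^ M)" .
    have "(\<Prod>z\<in>S - W \<rho>. measure_pmf.prob (lazy_step (p i)) (- {the (\<rho> z)}) ^ M) \<le> (\<Prod>z\<in>S - W \<rho>. c)"
    proof (rule prod_mono)
      fix z assume z: "z \<in> S - W \<rho>"
      then have "\<rho> z \<in> R" "\<rho> z \<noteq> None" using \<rho> by (auto simp: W_def)
      then have "the (\<rho> z) \<in> {f, g}" by (auto simp: R_def)
      then show "0 \<le> measure_pmf.prob (lazy_step (p i)) (- {the (\<rho> z)}) ^ M \<and>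
          measure_pmf.prob (lazy_step (p i)) (- {the (\<rho> z)}) ^ M \<le> c"
        using miss by simp
    qed
    moreover have "measure_pmf.prob \<mu> {..<M} ^ card (W \<rho>) \<le> c ^ card (W \<rho>)"
      using few by (intro power_mono) simp_all
    ultimately have 3: "measure_pmf.prob \<mu> {..<M} ^ card (W \<rho>) *
        (\<Prod>z\<in>S - W \<rho>. measure_pmf.prob (lazy_step (p i)) (- {the (\<rho> z)}) ^ M)
        \<le> c ^ card (W \<rho>) * c ^ card (S - W \<rho>)"
      using c by (intro mult_mono) (simp_all add: prod_nonneg)
    have card: "card (W \<rho>) + card (S - W \<rho>) = card S"
      using S(1) by (subst card_Un_disjoint[symmetric]) (auto simp: W_def intro!: arg_cong[of _ _ card])
    have "prob (C \<rho>) = ?a * ?b * (measure_pmf.prob \<mu> {..<M} ^ card (W \<rho>) *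
        (\<Prod>z\<in>S - W \<rho>. measure_pmf.prob (lazy_step (p i)) (- {the (\<rho> z)}) ^ M))"
      unfolding C_def using fin fin' by (subst prob_cylinder) (simp_all only: finite_Un finite_imageI 1 2 mult_ac simp_thms)
    also have "\<dots> \<le> ?a * ?b * (c ^ card (W \<rho>) * c ^ card (S - W \<rho>))"
      using 3 by (intro mult_left_mono) (simp_all add: prod_nonneg)
    also have "\<dots> = prob (cylinder A F B G) * c ^ card S"
      using fin by (simp add: prob_cylinder card[symmetric] power_add)
    finally show ?thesis .
  qed
  have C_sets: "C \<rho> \<in> events" for \<rho>
    unfolding C_def using fin fin' by (intro cylinder_sets) auto
  have finR: "finite (S \<rightarrow>\<^sub>E R)"
    using S(1) by (intro finite_PiE) (auto simp: R_def)
  have "prob {\<omega>\<in>cylinder A F B G. \<forall>z\<in>S. \<not> open_cell M s y f g i \<omega> z} \<le> prob (\<Union>\<rho>\<in>S \<rightarrow>\<^sub>E R. C \<rho>)"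
    using sub C_sets finR by (intro finite_measure_mono sets.finite_UN) auto
  also have "\<dots> \<le> (\<Sum>\<rho>\<in>S \<rightarrow>\<^sub>E R. prob (C \<rho>))"
    using C_sets finR by (intro measure_UNION_le) auto
  also have "\<dots> \<le> (\<Sum>\<rho>\<in>S \<rightarrow>\<^sub>E R. prob (cylinder A F B G) * c ^ card S)"
    by (intro sum_mono C_le)
  \<comment> \<open>There is one summand per choice of reasons, so three reasons per cell lead to
    the factor 3.\<close>
  also have "\<dots> = real (card R ^ card S) * (prob (cylinder A F B G) * c ^ card S)"
    using S(1) by (simp add: card_PiE)
  also have "\<dots> \<le> 3 ^ card S * (prob (cylinder A F B G) * c ^ card S)"
  proof (rule mult_right_mono)
    have "card R \<le> 3" by (auto simp: R_def card_insert_if)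
    then have "real (card R) ^ card S \<le> 3 ^ card S" by (intro power_mono) simp_all
    then show "real (card R ^ card S) \<le> 3 ^ card S" by simp
  qed (use c in simp)
  finally show ?thesis by (simp add: power_mult_distrib mult_ac)
qed

text \<open>With \<open>c = r ^ 4 / 3\<close> the three reasons together cost \<open>r ^ 4\<close>
  per cell, as the contour bound requires; \<open>r \<le> 1 / 6\<close> simplifies that bound to
  \<open>3 * r\<close>.\<close>

lemma percolation_fails_cylinder_le:
  fixes A :: "'d site set" and f g y :: "'d site" and r :: real
  assumes fin: "finite A" "finite B"
    and early: "\<And>b. b \<in> B \<Longrightarrow> snd (snd b) < s"
    and off: "\<And>z. 0 \<le> fst z \<Longrightarrow> 0 \<le> snd z \<Longrightarrow> cell_site y f g z \<notin> A"
    and inj: "inj (cell_site y f g)"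
    and r: "0 < r" "r \<le> 1 / 6"
    and few: "measure_pmf.prob \<mu> {..<M} \<le> r ^ 4 / 3"
    and miss: "\<And>v. v \<in> {f, g} \<Longrightarrow> measure_pmf.prob (lazy_step (p i)) (- {v}) ^ M \<le> r ^ 4 / 3"
  shows "prob {\<omega>\<in>cylinder A F B G. \<not> (\<forall>n. wet_level (open_cell M s y f g i \<omega>) n \<noteq> {})}
    \<le> prob (cylinder A F B G) * (3 * r)"
proof -
  have "prob {\<omega>\<in>cylinder A F B G. \<not> (\<forall>n. wet_level (open_cell M s y f g i \<omega>) n \<noteq> {})}
      \<le> prob (cylinder A F B G) * (r + r / (1 - 3 * r))"
  proof (rule percolation_fails_le)
    show "prob {\<omega>\<in>cylinder A F B G. \<forall>z\<in>S. \<not> open_cell M s y f g i \<omega> z}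
        \<le> prob (cylinder A F B G) * (r ^ 4) ^ card S"
      if "finite S" "S \<subseteq> {z. 0 \<le> fst z \<and> 0 \<le> snd z}" for S
      using prob_closed_cells_le[OF fin early off inj few miss that] by simp
  qed (use fin r in \<open>auto intro: cylinder_sets open_cell_sets\<close>)
  also have "r / (1 - 3 * r) \<le> 2 * r"
  proof -
    have "0 \<le> r * (1 - 6 * r)" using r by simp
    then show ?thesis using r by (simp add: divide_le_eq algebra_simps)
  qed
  then have "prob (cylinder A F B G) * (r + r / (1 - 3 * r)) \<le> prob (cylinder A F B G) * (3 * r)"
    by (intro mult_left_mono) auto
  finally show ?thesis .
qed

lemma percolates_sets:
  "{\<omega>\<in>space N. \<forall>n. wet_level (open_cell M s y f g i \<omega>) n \<noteq> {}} \<in> events"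
  by (rule percolation_measurable) (rule open_cell_sets)

end

subsection \<open>Geometry of the territories\<close>

text \<open>Subsets of the coordinates encode the corners of a cube, and there are as many corners
  as types.\<close>

lemma exists_sign_vectors:
  "\<exists>\<epsilon> :: nat \<Rightarrow> ('d::finite) site. inj_on \<epsilon> {1..2 ^ CARD('d)} \<and> (\<forall>i l. \<bar>\<epsilon> i $ l\<bar> = 1)"
proof -
  have "card (UNIV :: 'd set set) = 2 ^ CARD('d)"
    by (metis Pow_UNIV card_Pow finite)
  then obtain h :: "nat \<Rightarrow> 'd set" where h: "bij_betw h {1..2 ^ CARD('d)} UNIV"
    using finite_same_card_bij[of "{1::nat..2 ^ CARD('d)}" "UNIV :: 'd set set"] by auto
  define \<epsilon> :: "nat \<Rightarrow> 'd site" where "\<epsilon> i = (\<chi> l. if l \<in> h i then 1 else -1)" for i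
  have "inj_on \<epsilon> {1..2 ^ CARD('d)}"
  proof (rule inj_onI)
    fix i j assume ij: "i \<in> {1..2 ^ CARD('d)}" "j \<in> {1..2 ^ CARD('d)}" "\<epsilon> i = \<epsilon> j"
    have "l \<in> h i \<longleftrightarrow> l \<in> h j" for l
      using arg_cong[OF ij(3), of "\<lambda>v. v $ l"] by (simp add: \<epsilon>_def split: if_splits)
    then have "h i = h j" by blast
    with h ij(1,2) show "i = j" by (auto simp: bij_betw_def dest: inj_onD)
  qed
  moreover have "\<bar>\<epsilon> i $ l\<bar> = 1" for i l by (simp add: \<epsilon>_def)
  ultimately show ?thesis by blast
qed

text \<open>Cycling \<open>R\<close> times through all coordinates uses each of them exactly
  \<open>R\<close> times.\<close>

lemma exists_balanced_coordinates:
  "\<exists>g :: nat \<Rightarrow> 'd::finite. \<forall>F :: 'd \<Rightarrow> int. (\<Sum>m<R * CARD('d). F (g m)) = int R * (\<Sum>l\<in>UNIV. F l)"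
proof -
  obtain e :: "nat \<Rightarrow> 'd" where e: "bij_betw e {0..<CARD('d)} UNIV"
    using ex_bij_betw_nat_finite[of "UNIV :: 'd set"] by auto
  have "(\<Sum>m<R * CARD('d). F (e (m mod CARD('d)))) = int R * (\<Sum>l\<in>UNIV. F l)" for F :: "'d \<Rightarrow> int"
  proof -
    have "(\<Sum>m<R * CARD('d). F (e (m mod CARD('d)))) =
        (\<Sum>k<R. \<Sum>m\<in>{k * CARD('d)..<k * CARD('d) + CARD('d)}. F (e (m mod CARD('d))))"
      by (rule sum.nat_group[symmetric])
    also have "\<dots> = (\<Sum>k<R. \<Sum>l\<in>UNIV. F l)"
    proof (rule sum.cong)
      fix k
      have "(\<Sum>m\<in>{k * CARD('d)..<k * CARD('d) + CARD('d)}. F (e (m mod CARD('d)))) =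
          (\<Sum>m\<in>{0..<CARD('d)}. F (e m))"
        by (subst sum.atLeastLessThan_shift_0) simp
      also have "\<dots> = (\<Sum>l\<in>UNIV. F l)" by (rule sum.reindex_bij_betw[OF e])
      finally show "(\<Sum>m\<in>{k * CARD('d)..<k * CARD('d) + CARD('d)}. F (e (m mod CARD('d)))) = (\<Sum>l\<in>UNIV. F l)" .
    qed simp
    finally show ?thesis by simp
  qed
  then show ?thesis by (intro exI[of _ "\<lambda>m. e (m mod CARD('d))"] allI)
qed

text \<open>Type \<open>i\<close> moves by its signs \<open>\<epsilon> i\<close>, cycling through
  the coordinates, so its own height rises by 1 per step. Another type has a different sign in some
  coordinate, which is used \<open>R\<close> times by time \<open>t\<close>; it falls behind by at
  least \<open>R\<close>, more than any initial lead.\<close>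

lemma exists_routes:
  fixes x \<epsilon> :: "nat \<Rightarrow> ('d::finite) site"
  assumes I: "finite I" and \<epsilon>: "inj_on \<epsilon> I" "\<And>i l. \<bar>\<epsilon> i $ l\<bar> = 1"
  obtains t \<pi> where "0 < t" "\<And>i. \<pi> i 0 = x i" "\<And>i n. \<pi> i (Suc n) - \<pi> i n \<in> unit_steps"
    "\<And>i j n. i \<in> I \<Longrightarrow> j \<in> I \<Longrightarrow> n \<le> t \<Longrightarrow> n < t \<or> j \<noteq> i \<Longrightarrow>
      height (\<epsilon> i) (\<pi> j n) < height (\<epsilon> i) (\<pi> i t)"
proof -
  define K where "K = (\<lambda>(i, j). height (\<epsilon> i) (x j) - height (\<epsilon> i) (x i)) ` (I \<times> I)"
  define R where "R = Suc (nat (Max (insert 0 K)))"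
  have R: "height (\<epsilon> i) (x j) - height (\<epsilon> i) (x i) < int R" if "i \<in> I" "j \<in> I" for i j
  proof -
    have "height (\<epsilon> i) (x j) - height (\<epsilon> i) (x i) \<in> K" using that by (auto simp: K_def)
    then have "height (\<epsilon> i) (x j) - height (\<epsilon> i) (x i) \<le> Max (insert 0 K)"
      using I by (intro Max_ge) (auto simp: K_def)
    then show ?thesis by (simp add: R_def)
  qed
  define t where "t = R * CARD('d)"
  obtain g :: "nat \<Rightarrow> 'd" where g: "\<And>F :: 'd \<Rightarrow> int. (\<Sum>m<t. F (g m)) = int R * (\<Sum>l\<in>UNIV. F l)"
    using exists_balanced_coordinates[of R, where 'd='d] unfolding t_def by metis
  define \<pi> where "\<pi> i n = x i + (\<Sum>m<n. axis (g m) (\<epsilon> i $ g m))" for i n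
  have height_\<pi>: "height a (\<pi> i n) = height a (x i) + (\<Sum>m<n. a $ g m * \<epsilon> i $ g m)" for a i n
    by (induction n) (simp_all add: \<pi>_def add.assoc[symmetric] height_add height_axis)
  have sq: "\<epsilon> i $ l * \<epsilon> i $ l = 1" for i l
    using \<epsilon>(2)[of i l] by (metis abs_mult_self_eq mult_1)
  have own: "height (\<epsilon> i) (\<pi> i n) = height (\<epsilon> i) (x i) + int n" for i n
    by (simp add: height_\<pi> sq)
  have other: "height (\<epsilon> i) (\<pi> j n) < height (\<epsilon> i) (\<pi> i t)"
    if "i \<in> I" "j \<in> I" "n \<le> t" "j \<noteq> i" for i j n
  proof -
    have "\<epsilon> i \<noteq> \<epsilon> j" using \<epsilon>(1) that by (auto dest: inj_onD)
    then obtain l where l: "\<epsilon> i $ l \<noteq> \<epsilon> j $ l" by (auto simp: vec_eq_iff)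
    \<comment> \<open>A nonnegative bound instead of the product itself, so that the sum over
      \<open>m < n\<close> can be extended to \<open>m < t\<close>.\<close>
    have le: "\<epsilon> i $ k * \<epsilon> j $ k \<le> of_bool (k \<noteq> l)" for k
      using \<epsilon>(2)[of i k] \<epsilon>(2)[of j k] l by (auto simp: abs_if split: if_splits)
    have "(\<Sum>m<n. \<epsilon> i $ g m * \<epsilon> j $ g m) \<le> (\<Sum>m<n. of_bool (g m \<noteq> l))"
      by (intro sum_mono le)
    also have "\<dots> \<le> (\<Sum>m<t. of_bool (g m \<noteq> l))"
      using that(3) by (intro sum_mono2) auto
    also have "\<dots> = int R * (\<Sum>k\<in>UNIV. of_bool (k \<noteq> l))" by (rule g)
    also have "(\<Sum>k\<in>UNIV. of_bool (k \<noteq> l)) = int CARD('d) - 1"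
      by (simp add: of_bool_def sum.If_cases card_Diff_singleton Compl_eq_Diff_UNIV Collect_neg_eq
          int_ops(6) Suc_le_eq)
    finally have "height (\<epsilon> i) (\<pi> j n) \<le> height (\<epsilon> i) (x j) + int R * (int CARD('d) - 1)"
      by (simp add: height_\<pi>)
    also have "\<dots> < height (\<epsilon> i) (x i) + int t"
      using R[OF that(1,2)] by (simp add: t_def algebra_simps)
    finally show ?thesis by (simp add: own)
  qed
  show thesis
  proof (rule that)
    show "0 < t" by (simp add: t_def R_def)
    show "\<pi> i 0 = x i" for i by (simp add: \<pi>_def)
    show "\<pi> i (Suc n) - \<pi> i n \<in> unit_steps" for i n
      using \<epsilon>(2)[of i "g n"] by (auto simp: \<pi>_def unit_steps_def abs_if split: if_splits)
    show "height (\<epsilon> i) (\<pi> j n) < height (\<epsilon> i) (\<pi> i t)"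
      if "i \<in> I" "j \<in> I" "n \<le> t" "n < t \<or> j \<noteq> i" for i j n
      using other[OF that(1-3)] that(4) by (cases "j = i") (auto simp: own)
  qed
qed

section \<open>Deterministic survival criteria for the two parts\<close>

context frog_run
begin

lemma conf_type: "conf n q = Some (z, j) \<Longrightarrow> j \<in> I"
proof (induction n arbitrary: q z)
  case 0
  then show ?case by (simp add: conf_zero)
next
  case (Suc n)
  then show ?case using conf_predecessor by blast
qed

text \<open>The steps are prescribed for every type that a particle might get, so whatever a tie
  decides, the particle joins the route of its type. The bound \<open>snd q \<le> m\<close> is not
  strict: it covers the starting particle, with index 0, even if \<open>m = 0\<close>.\<close>

lemma conf_on_routes:
  assumes \<pi>: "\<And>i. \<pi> i 0 = x i"
    and m: "\<And>j n. j \<in> I \<Longrightarrow> n < t \<Longrightarrow> \<eta> (\<pi> j n) = m"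
    and follow: "\<And>q j n. fst q \<in> (\<lambda>(j, n). \<pi> j n) ` (I \<times> {..<t}) \<Longrightarrow> snd q \<le> m \<Longrightarrow> j \<in> I \<Longrightarrow> n < t \<Longrightarrow>
      \<xi> (q, j, n) = \<pi> j (Suc n) - \<pi> j n"
  shows "conf n q = Some (z, j) \<Longrightarrow> n \<le> t \<Longrightarrow>
    z = \<pi> j n \<and> (n < t \<longrightarrow> fst q \<in> (\<lambda>(j, n). \<pi> j n) ` (I \<times> {..<t}) \<and> snd q \<le> m)"
proof (induction n arbitrary: q z j)
  case 0
  then have "j \<in> I" "z = x j" "q = (x j, 0)" by (simp_all add: conf_zero)
  then show ?case using \<pi>[of j] by (auto intro!: image_eqI[of _ _ "(j, 0)"])
next
  case (Suc n)
  note j = conf_type[OF Suc.prems(1)]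
  have next_z: "w + \<xi> (q', j, n) = \<pi> j (Suc n)" if "conf n q' = Some (w, j)" for q' w
    using Suc.IH[OF that] follow[of q' j n] Suc.prems(2) j by simp
  show ?case
  proof (cases "conf n q")
    case None
    from conf_newD[OF None Suc.prems(1)] next_z
    have z: "fst q = z" "snd q < \<eta> z" "z = \<pi> j (Suc n)" by auto
    then show ?thesis
      using m[OF j, of "Suc n"] j by (auto intro!: image_eqI[of _ _ "(j, Suc n)"])
  next
    case (Some a)
    then obtain w i where a: "conf n q = Some (w, i)" by (cases a) auto
    from conf_move[OF a] Suc.prems(1) have "i = j" "z = w + \<xi> (q, i, n)" by auto
    with a next_z Suc.IH[OF a] Suc.prems(2) show ?thesis by simp
  qed
qed

text \<open>At time \<open>t\<close> type \<open>i\<close> sits at the corner of its quadrant,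
  strictly higher than all other types in direction \<open>e\<close>. Each step along the quadrant
  gains height 1, the maximum possible, so the others can never catch up there.\<close>

lemma routes_survive:
  fixes \<pi> :: "nat \<Rightarrow> nat \<Rightarrow> 'd site" and e :: "'d site"
  assumes step: "\<And>q j n. \<xi> (q, j, n) \<in> insert 0 unit_steps"
    and \<pi>: "\<And>i. \<pi> i 0 = x i"
    and m: "\<And>j n. j \<in> I \<Longrightarrow> n < t \<Longrightarrow> \<eta> (\<pi> j n) = m"
    and follow: "\<And>q j n. fst q \<in> (\<lambda>(j, n). \<pi> j n) ` (I \<times> {..<t}) \<Longrightarrow> snd q \<le> m \<Longrightarrow> j \<in> I \<Longrightarrow> n < t \<Longrightarrow>
      \<xi> (q, j, n) = \<pi> j (Suc n) - \<pi> j n"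
    and t: "0 < t" and M: "0 < M" and i: "i \<in> I"
    and low: "\<And>j n. j \<in> I \<Longrightarrow> n \<le> t \<Longrightarrow> n < t \<or> j \<noteq> i \<Longrightarrow>
      height e (\<pi> j n) < height e (\<pi> i t)"
    and e: "\<And>l. \<bar>e $ l\<bar> = 1" and l: "l \<noteq> l'"
    and wet: "\<And>n. wet_level (open_cell M t (\<pi> i t) (axis l (e $ l)) (axis l' (e $ l')) i (\<eta>, \<xi>, u)) n \<noteq> {}"
  shows "survives I x \<tau> (\<eta>, \<xi>, u) i"
proof -
  have on_route: "z = \<pi> j n" if "conf n q = Some (z, j)" "n \<le> t" for n q z j
    using conf_on_routes[OF _ _ _ that] \<pi> m follow by blast
  let ?site = "cell_site (\<pi> i t) (axis l (e $ l)) (axis l' (e $ l'))"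
  let ?h = "height e"
  have sq: "e $ k * e $ k = 1" for k
    using e[of k] by (metis abs_mult_self_eq mult_1)
  have nz: "e $ k \<noteq> 0" for k using e[of k] by auto
  have h_site: "?h (?site z) = ?h (\<pi> i t) + fst z + snd z" for z
    by (simp add: height_cell_site height_axis sq)
  have h_own: "?h w \<le> ?h (\<pi> i t) + int n" if "conf (t + n) q = Some (w, i)" for n q w
    by (rule conf_height_le[OF step _ _ that]) (use e on_route in auto)
  have h_other: "?h w \<le> ?h (\<pi> i t) - 1 + int n" if "conf (t + n) q = Some (w, j)" "j \<noteq> i" for n q w j
  proof (rule conf_height_le[OF step _ _ that(1)])
    show "?h z \<le> ?h (\<pi> i t) - 1" if "conf t q = Some (z, j)" for q z
      using on_route[OF that] low[OF conf_type[OF that], of t] \<open>j \<noteq> i\<close> by simp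
  qed (use e in auto)
  \<comment> \<open>The starting particle of type \<open>i\<close> witnesses the arrival at the
    corner.\<close>
  have lead: "conf n (x i, 0) = Some (\<pi> i n, i)" if "n \<le> t" for n
    using that
  proof (induction n)
    case 0
    then show ?case using i \<pi> by (simp add: conf_zero)
  next
    case (Suc n)
    have "x i \<in> (\<lambda>(j, n). \<pi> j n) ` (I \<times> {..<t})"
      using i t \<pi>[of i] by (auto intro!: image_eqI[of _ _ "(i, 0)"])
    with Suc follow[of "(x i, 0)" i n] i conf_move[of n "(x i, 0)" "\<pi> i n" i] show ?case by simp
  qed
  show ?thesis
  proof (rule percolation_survives[OF t lead[OF order_refl] M inj_cell_site[OF l nz nz] _ _ wet])
    fix z n q j assume z: "0 \<le> fst z" "0 \<le> snd z" "n < t + nat (fst z + snd z)"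
    show "conf n q \<noteq> Some (?site z, j)"
    proof
      assume c: "conf n q = Some (?site z, j)"
      show False
      proof (cases "n < t")
        case True
        then show False
          using on_route[OF c] low[OF conf_type[OF c], of n] h_site[of z] z(1,2) by simp
      next
        case False
        then obtain k where k: "n = t + k" using le_Suc_ex not_less by blast
        have "int k < fst z + snd z" using z k by linarith
        then show False
          using h_own[of k q "?site z"] h_other[of k q "?site z" j] c h_site[of z] unfolding k
          by (cases "j = i") auto
      qed
    qed
  next
    fix z q j assume z: "0 \<le> fst z" "0 \<le> snd z" "conf (t + nat (fst z + snd z)) q = Some (?site z, j)"
    then show "j = i"
      using h_other[OF z(3)] h_site[of z] by (cases "j = i") auto
  qed
qed

text \<open>The quadrant is transversal to the line, and its corner is one step off the line.
  Functionals equal to 1 on \<open>l1\<close> and \<open>l2\<close> measure progress in it; their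
  coefficient on \<open>l\<close> is free and serves to compare starting sites.\<close>

lemma line_survives:
  assumes step: "\<And>q j n. \<xi> (q, j, n) \<in> insert 0 unit_steps"
    and line: "\<And>i j k. i \<in> I \<Longrightarrow> j \<in> I \<Longrightarrow> k \<noteq> l \<Longrightarrow> x i $ k = x j $ k"
    and l: "l1 \<noteq> l2" "l1 \<noteq> l" "l2 \<noteq> l"
    and M: "0 < M" and i: "i \<in> I"
    and lead: "\<xi> ((x i, 0), i, 0) = axis l1 1"
    and wet: "\<And>n. wet_level (open_cell M 1 (x i + axis l1 1) (axis l1 1) (axis l2 1) i (\<eta>, \<xi>, u)) n \<noteq> {}"
  shows "survives I x \<tau> (\<eta>, \<xi>, u) i"
proof -
  let ?site = "cell_site (x i + axis l1 1) (axis l1 1) (axis l2 1)"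
  define a :: "int \<Rightarrow> 'd site" where
    "a \<sigma> = (\<chi> k. if k = l then \<sigma> else if k = l1 \<or> k = l2 then 1 else 0)" for \<sigma>
  have a_le: "\<bar>a \<sigma> $ k\<bar> \<le> 1" if "\<bar>\<sigma>\<bar> \<le> 1" for \<sigma> k
    using that by (simp add: a_def)
  have h_site: "height (a \<sigma>) (?site z) = height (a \<sigma>) (x i) + 1 + fst z + snd z" for z \<sigma>
    using l by (simp add: height_cell_site height_add height_axis a_def)
  have h_start: "height (a \<sigma>) (x j) = height (a \<sigma>) (x i) + \<sigma> * (x j $ l - x i $ l)" if "j \<in> I" for j \<sigma>
  proof -
    have "height (a \<sigma>) (x j) - height (a \<sigma>) (x i) = (\<Sum>k\<in>UNIV. a \<sigma> $ k * (x j $ k - x i $ k))"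
      by (simp add: height_def sum_subtractf algebra_simps)
    also have "\<dots> = (\<Sum>k\<in>UNIV. if k = l then \<sigma> * (x j $ k - x i $ k) else 0)"
      using line[OF that i] by (intro sum.cong) (auto simp: a_def)
    finally show ?thesis by simp
  qed
  have h_le: "height (a \<sigma>) w \<le> height (a \<sigma>) (x i) + \<sigma> * (x j $ l - x i $ l) + int n"
    if "conf n q = Some (w, j)" "\<bar>\<sigma>\<bar> \<le> 1" for n q w j \<sigma>
  proof -
    have "conf (0 + n) q = Some (w, j)" using that(1) by simp
    from conf_height_le[OF step a_le[OF that(2)] _ this] show ?thesis
      using h_start[of j \<sigma>] by (auto simp: conf_zero)
  qed
  have arrival: "conf 1 (x i, 0) = Some (x i + axis l1 1, i)"
    using conf_move[of 0 "(x i, 0)" "x i" i] i lead by (simp add: conf_zero)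
  show ?thesis
  proof (rule percolation_survives[OF zero_less_one arrival M inj_cell_site[OF l(1)] _ _ wet])
    fix z n q j assume z: "0 \<le> fst z" "0 \<le> snd z" "n < 1 + nat (fst z + snd z)"
    show "conf n q \<noteq> Some (?site z, j)"
    proof
      assume "conf n q = Some (?site z, j)"
      from h_le[OF this, of 0] h_site[of 0 z] have "1 + fst z + snd z \<le> int n" by simp
      with z show False by linarith
    qed
  next
    fix z q j assume z: "0 \<le> fst z" "0 \<le> snd z" "conf (1 + nat (fst z + snd z)) q = Some (?site z, j)"
    \<comment> \<open>This sign points from \<open>x j\<close> towards \<open>x i\<close>, so type
      \<open>j\<close> starts strictly lower unless the two sites coincide. With coefficient 0, as
      used above, all types start level, which gives the earliest arrival time.\<close>
    define \<sigma> where "\<sigma> = sgn (x i $ l - x j $ l)"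
    have "\<bar>\<sigma>\<bar> \<le> 1" by (simp add: \<sigma>_def sgn_if)
    from h_le[OF z(3) this] h_site[of \<sigma> z] z(1,2)
    have "0 \<le> \<sigma> * (x j $ l - x i $ l)" by simp
    then have "x i $ l = x j $ l" by (auto simp: \<sigma>_def sgn_if split: if_splits)
    then have "x i $ k = x j $ k" for k
      using line[OF i conf_type[OF z(3)], of k] by (cases "k = l") simp_all
    then have "x i = x j" by (simp add: vec_eq_iff)
    then show "j = i" using inj i conf_type[OF z(3)] by (auto dest: inj_onD)
  qed simp_all
qed

end

text \<open>Continuity from above along the unions of the tails; the events may be
  dependent.\<close>

lemma (in prob_space) prob_infinitely_often_ge:
  fixes A :: "nat \<Rightarrow> 'a set"
  assumes A: "\<And>n. m \<le> n \<Longrightarrow> A n \<in> events" "\<And>n. m \<le> n \<Longrightarrow> c \<le> prob (A n)"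
  shows "c \<le> prob {\<omega>\<in>space M. infinite {n\<in>{m..}. \<omega> \<in> A n}}"
proof -
  define B where "B k = (\<Union>n\<in>{max m k..}. A n)" for k
  have B: "B k \<in> events" for k unfolding B_def using A(1) by (intro sets.countable_UN') auto
  have "decseq B" unfolding B_def by (intro decseq_SucI UN_mono) auto
  then have "(\<lambda>k. prob (B k)) \<longlonglongrightarrow> prob (\<Inter>k. B k)"
    using B by (intro finite_Lim_measure_decseq) auto
  moreover have "c \<le> prob (B k)" for k
  proof -
    have "c \<le> prob (A (max m k))" by (rule A(2)) simp
    also have "\<dots> \<le> prob (B k)" using B by (intro finite_measure_mono) (auto simp: B_def)
    finally show ?thesis .
  qed
  ultimately have "c \<le> prob (\<Inter>k. B k)" by (intro LIMSEQ_le_const) auto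
  also have "(\<Inter>k. B k) = {\<omega>\<in>space M. infinite {n\<in>{m..}. \<omega> \<in> A n}}"
  proof -
    have "\<omega> \<in> space M" if "\<omega> \<in> (\<Inter>k. B k)" for \<omega>
      using that sets.sets_into_space[OF B[of 0]] by blast
    moreover have "\<omega> \<in> (\<Inter>k. B k) \<longleftrightarrow> infinite {n\<in>{m..}. \<omega> \<in> A n}" for \<omega>
      unfolding infinite_nat_iff_unbounded_le B_def by (auto simp: Bex_def)
    ultimately show ?thesis by blast
  qed
  finally show ?thesis .
qed

subsection \<open>Coexistence\<close>

context frog_law
begin

lemma few_particles_le:
  assumes "1 - c \<le> measure_pmf.prob \<mu> {M..}"
  shows "measure_pmf.prob \<mu> {..<M} \<le> c"
proof -
  have "measure_pmf.prob \<mu> {..<M} = 1 - measure_pmf.prob \<mu> {M..}"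
    using measure_pmf.prob_compl[of "{M..}" \<mu>] by (simp add: Compl_eq_Diff_UNIV[symmetric] Compl_atLeast)
  with assms show ?thesis by simp
qed

text \<open>Replacing \<open>p i\<close> by a common lower bound \<open>q\<close> allows one
  \<open>M\<close> for all types.\<close>

lemma missed_step_le:
  fixes v :: "'d site"
  assumes "0 < q" "q \<le> p i" "p i \<le> 1" "v \<in> unit_steps" "(1 - q / (2 * CARD('d))) ^ M \<le> c"
  shows "measure_pmf.prob (lazy_step (p i)) (- {v}) ^ M \<le> c"
proof -
  have "measure_pmf.prob (lazy_step (p i)) (- {v}) \<le> 1 - p i / (2 * CARD('d))"
    using assms by (intro prob_lazy_step_avoid) auto
  also have "\<dots> \<le> 1 - q / (2 * CARD('d))"
    using assms(2) by (simp add: divide_right_mono)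
  finally have "measure_pmf.prob (lazy_step (p i)) (- {v}) ^ M \<le> (1 - q / (2 * CARD('d))) ^ M"
    by (intro power_mono) simp_all
  with assms(5) show ?thesis by simp
qed

text \<open>The initial phase is a cylinder \<open>E\<close> of positive probability. Relative to
  \<open>E\<close> each percolation fails with probability at most \<open>3 * r\<close>, so the
  union bound over all types leaves a positive part of \<open>E\<close>.\<close>

lemma coexistence_of_orthants:
  fixes x :: "nat \<Rightarrow> 'd site" and r q :: real
  defines "I \<equiv> {1..2 ^ CARD('d)}"
  assumes d: "2 \<le> CARD('d)" and p: "\<And>i. i \<in> I \<Longrightarrow> q \<le> p i \<and> p i \<le> 1" and q: "0 < q"
    and inj: "inj_on x I" and tie: "tie_breaking \<tau>"
    and r: "0 < r" "r \<le> 1 / 6" "2 ^ CARD('d) * (3 * r) < 1"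
    and M: "(1 - q / (2 * CARD('d))) ^ M \<le> r ^ 4 / 3" "0 < M"
    and \<mu>: "1 - r ^ 4 / 3 \<le> measure_pmf.prob \<mu> {M..}"
  shows "0 < prob {\<omega>\<in>space N. \<forall>i\<in>I. survives I x \<tau> \<omega> i}"
proof -
  obtain \<epsilon> :: "nat \<Rightarrow> 'd site" where \<epsilon>: "inj_on \<epsilon> I" "\<And>i l. \<bar>\<epsilon> i $ l\<bar> = 1"
    using exists_sign_vectors[where 'd='d] unfolding I_def by blast
  have finI: "finite I" and cardI: "card I = 2 ^ CARD('d)" by (simp_all add: I_def)
  obtain t \<pi> where t: "0 < t" and \<pi>: "\<And>i. \<pi> i 0 = x i"
    and \<pi>_step: "\<And>i n. \<pi> i (Suc n) - \<pi> i n \<in> unit_steps"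
    and low: "\<And>i j n. i \<in> I \<Longrightarrow> j \<in> I \<Longrightarrow> n \<le> t \<Longrightarrow> n < t \<or> j \<noteq> i \<Longrightarrow>
      height (\<epsilon> i) (\<pi> j n) < height (\<epsilon> i) (\<pi> i t)"
    using exists_routes[OF finI \<epsilon>] by metis
  obtain l l' :: 'd where l: "l \<noteq> l'"
    using d by (metis card_2_iff' card_eq_0_iff ex_card UNIV_I)
  \<comment> \<open>Any number of particles with positive mass serves for the sites of the routes;
    it may be smaller than \<open>M\<close>.\<close>
  obtain m where m: "m \<in> set_pmf \<mu>" using set_pmf_not_empty by fast
  define A where "A = (\<lambda>(j, n). \<pi> j n) ` (I \<times> {..<t})"
  define B where "B = (A \<times> {..m}) \<times> I \<times> {..<t}"
  define E where "E = cylinder A (\<lambda>_. {m}) B (\<lambda>(_, j, n). {\<pi> j (Suc n) - \<pi> j n})"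
  have fin: "finite A" "finite B" using finI by (simp_all add: A_def B_def)
  have E: "E \<in> events" unfolding E_def using fin by (rule cylinder_sets)
  have E_pos: "0 < prob E"
  proof -
    have "0 < measure_pmf.prob (lazy_step (p j)) {\<pi> j (Suc n) - \<pi> j n}" if "j \<in> I" for j n
    proof -
      have "0 < p j" "p j \<le> 1" using p[OF that] q by auto
      then have "0 < p j / (2 * CARD('d))" by simp
      also have "\<dots> \<le> pmf (lazy_step (p j)) (\<pi> j (Suc n) - \<pi> j n)"
        by (rule pmf_lazy_step_ge) fact+
      finally show ?thesis by (simp add: measure_pmf_single)
    qed
    moreover have "0 < measure_pmf.prob \<mu> {m}" using m by (simp add: measure_pmf_single pmf_positive)
    ultimately show ?thesis
      unfolding E_def using fin by (subst prob_cylinder) (auto simp: B_def intro!: mult_pos_pos prod_pos)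
  qed
  define op where "op i = open_cell M t (\<pi> i t) (axis l (\<epsilon> i $ l)) (axis l' (\<epsilon> i $ l')) i" for i
  define X where "X i = {\<omega>\<in>E. \<not> (\<forall>n. wet_level (op i \<omega>) n \<noteq> {})}" for i
  have unit: "axis k (\<epsilon> i $ k) \<in> unit_steps" for i k
    using \<epsilon>(2)[of i k] by (auto simp: unit_steps_def abs_if split: if_splits)
  have X: "X i \<in> events" for i
  proof -
    have "X i = E - {\<omega>\<in>space N. \<forall>n. wet_level (op i \<omega>) n \<noteq> {}}"
      by (auto simp: X_def space_N)
    then show ?thesis using E percolates_sets by (simp add: op_def)
  qed
  have X_le: "prob (X i) \<le> prob E * (3 * r)" if i: "i \<in> I" for i
    unfolding X_def op_def E_def
  proof (rule percolation_fails_cylinder_le[OF fin _ _ _ r(1,2)])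
    show "snd (snd b) < t" if "b \<in> B" for b using that by (auto simp: B_def)
    have nz: "\<epsilon> i $ k \<noteq> 0" for k using \<epsilon>(2)[of i k] by auto
    show "inj (cell_site (\<pi> i t) (axis l (\<epsilon> i $ l)) (axis l' (\<epsilon> i $ l')))"
      by (rule inj_cell_site[OF l nz nz])
    show "cell_site (\<pi> i t) (axis l (\<epsilon> i $ l)) (axis l' (\<epsilon> i $ l')) z \<notin> A"
      if "0 \<le> fst z" "0 \<le> snd z" for z
    \<comment> \<open>Quadrant sites are at least as high as the corner, whereas every route is
      strictly below the corner before time \<open>t\<close>.\<close>
    proof -
      have "\<epsilon> i $ k * \<epsilon> i $ k = 1" for k using \<epsilon>(2)[of i k] by (metis abs_mult_self_eq mult_1)
      then have "height (\<epsilon> i) (\<pi> i t)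
          \<le> height (\<epsilon> i) (cell_site (\<pi> i t) (axis l (\<epsilon> i $ l)) (axis l' (\<epsilon> i $ l')) z)"
        using that by (simp add: height_cell_site height_axis)
      moreover have "height (\<epsilon> i) w < height (\<epsilon> i) (\<pi> i t)" if "w \<in> A" for w
        using that low[OF i] by (auto simp: A_def)
      ultimately show ?thesis by force
    qed
    show "measure_pmf.prob \<mu> {..<M} \<le> r ^ 4 / 3" by (rule few_particles_le) fact
    show "measure_pmf.prob (lazy_step (p i)) (- {v}) ^ M \<le> r ^ 4 / 3"
      if "v \<in> {axis l (\<epsilon> i $ l), axis l' (\<epsilon> i $ l')}" for v
      using that p[OF i] unit by (intro missed_step_le[OF q _ _ _ M(1)]) auto
  qed
  have UX: "(\<Union>i\<in>I. X i) \<in> events" "(\<Union>i\<in>I. X i) \<subseteq> E" using X finI by (auto simp: X_def)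
  have "prob (\<Union>i\<in>I. X i) \<le> (\<Sum>i\<in>I. prob (X i))"
    using X finI by (intro measure_UNION_le) auto
  also have "\<dots> \<le> (\<Sum>i\<in>I. prob E * (3 * r))" by (intro sum_mono X_le)
  also have "\<dots> = prob E * (2 ^ CARD('d) * (3 * r))" by (simp add: cardI)
  also have "\<dots> < prob E * 1" using E_pos r(3) by (rule mult_strict_left_mono[rotated])
  finally have "0 < prob (E - (\<Union>i\<in>I. X i))"
    using E UX by (simp add: finite_measure_Diff)
  also have "\<dots> \<le> prob {\<omega>\<in>space N. \<forall>i\<in>I. survives I x \<tau> \<omega> i}"
  proof (rule finite_measure_mono_AE)
    show "AE \<omega> in N. \<omega> \<in> E - (\<Union>i\<in>I. X i) \<longrightarrow> \<omega> \<in> {\<omega>\<in>space N. \<forall>i\<in>I. survives I x \<tau> \<omega> i}"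
      using AE_steps
    proof eventually_elim
      case (elim \<omega>)
      obtain \<eta> \<xi> u where \<omega>: "\<omega> = (\<eta>, \<xi>, u)" by (cases \<omega>)
      interpret frog_run I x \<tau> \<eta> \<xi> u using tie inj by unfold_locales
      show ?case
      proof (intro impI CollectI conjI ballI)
        fix i assume i: "i \<in> I" and \<omega>E: "\<omega> \<in> E - (\<Union>i\<in>I. X i)"
        show "survives I x \<tau> \<omega> i"
          unfolding \<omega>
        proof (rule routes_survive[where \<pi> = \<pi> and e = "\<epsilon> i" and m = m,
              OF _ \<pi> _ _ t M(2) i low[OF i] \<epsilon>(2) l])
          show "\<xi> (q, j, n) \<in> insert 0 unit_steps" for q j n
            using elim[rule_format, of "(q, j, n)"] by (simp add: \<omega>)
          show "\<eta> (\<pi> j n) = m" if "j \<in> I" "n < t" for j n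
            using \<omega>E that by (auto simp: E_def cylinder_def A_def \<omega>)
          show "\<xi> (q, j, n) = \<pi> j (Suc n) - \<pi> j n"
            if "fst q \<in> (\<lambda>(j, n). \<pi> j n) ` (I \<times> {..<t})" "snd q \<le> m" "j \<in> I" "n < t" for q j n
          proof -
            have "(q, j, n) \<in> B" using that by (cases q) (simp add: B_def A_def)
            then show ?thesis using \<omega>E by (force simp: E_def cylinder_def \<omega>)
          qed
          show "wet_level (open_cell M t (\<pi> i t) (axis l (\<epsilon> i $ l)) (axis l' (\<epsilon> i $ l')) i (\<eta>, \<xi>, u)) n \<noteq> {}" for n
            using \<omega>E i by (auto simp: X_def op_def \<omega>)
        qed
      qed (simp add: space_N)
    qed
    have "Measurable.pred N (\<lambda>\<omega>. \<forall>i\<in>I. survives I x \<tau> \<omega> i)"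
      using survives_measurable[OF tie inj] finI by measurable
    then show "{\<omega>\<in>space N. \<forall>i\<in>I. survives I x \<tau> \<omega> i} \<in> events" by (simp add: pred_def)
  qed
  finally show ?thesis .
qed

lemma coexistence_on_line:
  fixes x :: "nat \<Rightarrow> 'd site" and r q :: real and l :: 'd
  assumes d: "3 \<le> CARD('d)" and p: "\<And>i. 1 \<le> i \<Longrightarrow> q \<le> p i \<and> p i \<le> 1" and q: "0 < q"
    and inj: "inj_on x {1..}" and tie: "tie_breaking \<tau>"
    and line: "\<And>i j k. i \<in> {1..} \<Longrightarrow> j \<in> {1..} \<Longrightarrow> k \<noteq> l \<Longrightarrow> x i $ k = x j $ k"
    and r: "0 < r" "r \<le> 1 / 6"
    and M: "(1 - q / (2 * CARD('d))) ^ M \<le> r ^ 4 / 3" "0 < M"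
    and \<mu>: "1 - r ^ 4 / 3 \<le> measure_pmf.prob \<mu> {M..}"
  shows "0 < prob {\<omega>\<in>space N. infinite {i\<in>{1..}. survives {1..} x \<tau> \<omega> i}}"
proof -
  obtain l1 l2 where l: "l1 \<noteq> l2" "l1 \<noteq> l" "l2 \<noteq> l"
  proof -
    have "2 \<le> card (UNIV - {l})" using d by simp
    then obtain T where "T \<subseteq> UNIV - {l}" "card T = 2" by (meson obtain_subset_with_card_n)
    then show thesis using that by (auto simp: card_2_iff)
  qed
  have unit: "axis k 1 \<in> unit_steps" for k by (auto simp: unit_steps_def)
  \<comment> \<open>A first step in direction \<open>l1\<close> has probability at least
    \<open>q / (2 * CARD('d))\<close>, and percolation fails with relative probability at most
    \<open>3 * r\<close>; this bound is the same for all types.\<close>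
  define c where "c = q / (2 * CARD('d)) * (1 - 3 * r)"
  have "0 < c" using q r by (simp add: c_def)
  define S where "S i = {\<omega>\<in>space N. survives {1..} x \<tau> \<omega> i}" for i
  have S: "S i \<in> events" for i
  proof -
    have "Measurable.pred N (\<lambda>\<omega>. survives {1..} x \<tau> \<omega> i)"
      using survives_measurable[OF tie inj] by measurable
    then show ?thesis by (simp add: S_def pred_def)
  qed
  have "c \<le> prob (S i)" if i: "1 \<le> i" for i
  proof -
    define E where "E = cylinder {} (\<lambda>_. {}) {((x i, 0), i, 0)} (\<lambda>_. {axis l1 1})"
    define X where "X = {\<omega>\<in>E. \<not> (\<forall>n. wet_level
      (open_cell M 1 (x i + axis l1 1) (axis l1 1) (axis l2 1) i \<omega>) n \<noteq> {})}"
    have E: "E \<in> events" unfolding E_def by (rule cylinder_sets) simp_all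
    have X: "X \<in> events" "X \<subseteq> E"
    proof -
      have "X = E - {\<omega>\<in>space N. \<forall>n. wet_level
          (open_cell M 1 (x i + axis l1 1) (axis l1 1) (axis l2 1) i \<omega>) n \<noteq> {}}"
        by (auto simp: X_def space_N)
      then show "X \<in> events" using E percolates_sets by simp
    qed (auto simp: X_def)
    have "prob X \<le> prob E * (3 * r)"
      unfolding X_def E_def
    proof (rule percolation_fails_cylinder_le[OF _ _ _ _ _ r])
      show "inj (cell_site (x i + axis l1 1) (axis l1 1) (axis l2 1))"
        by (rule inj_cell_site[OF l(1)]) simp_all
      show "measure_pmf.prob \<mu> {..<M} \<le> r ^ 4 / 3" by (rule few_particles_le) fact
      show "measure_pmf.prob (lazy_step (p i)) (- {v}) ^ M \<le> r ^ 4 / 3"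
        if "v \<in> {axis l1 1, axis l2 1}" for v
        using that p[OF i] unit by (intro missed_step_le[OF q _ _ _ M(1)]) auto
    qed auto
    moreover have "q / (2 * CARD('d)) \<le> prob E"
    proof -
      have "q / (2 * CARD('d)) \<le> p i / (2 * CARD('d))"
        using p[OF i] by (intro divide_right_mono) auto
      also have "\<dots> \<le> pmf (lazy_step (p i)) (axis l1 1)"
        using p[OF i] q unit by (intro pmf_lazy_step_ge) auto
      also have "\<dots> = prob E" by (simp add: E_def prob_cylinder measure_pmf_single)
      finally show ?thesis .
    qed
    then have "c \<le> prob E * (1 - 3 * r)"
      unfolding c_def using r by (intro mult_right_mono) auto
    ultimately have "c \<le> prob (E - X)"
      using E X by (simp add: finite_measure_Diff algebra_simps)
    also have "\<dots> \<le> prob (S i)"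
    proof (rule finite_measure_mono_AE[OF _ S])
      show "AE \<omega> in N. \<omega> \<in> E - X \<longrightarrow> \<omega> \<in> S i"
        using AE_steps
      proof eventually_elim
        case (elim \<omega>)
        obtain \<eta> \<xi> u where \<omega>: "\<omega> = (\<eta>, \<xi>, u)" by (cases \<omega>)
        interpret frog_run "{1..}" x \<tau> \<eta> \<xi> u using tie inj by unfold_locales
        show ?case
        proof
          assume \<omega>E: "\<omega> \<in> E - X"
          have "survives {1..} x \<tau> (\<eta>, \<xi>, u) i"
          proof (rule line_survives[OF _ line l M(2)])
            show "\<xi> (q, j, n) \<in> insert 0 unit_steps" for q j n
            using elim[rule_format, of "(q, j, n)"] by (simp add: \<omega>)
            show "\<xi> ((x i, 0), i, 0) = axis l1 1"
              using \<omega>E by (simp add: E_def cylinder_def \<omega>)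
            show "wet_level (open_cell M 1 (x i + axis l1 1) (axis l1 1) (axis l2 1) i (\<eta>, \<xi>, u)) n \<noteq> {}" for n
              using \<omega>E by (auto simp: X_def \<omega>)
          qed (use i in auto)
          then show "\<omega> \<in> S i" by (simp add: S_def space_N \<omega>)
        qed
      qed
    qed
    finally show ?thesis .
  qed
  then have "c \<le> prob {\<omega>\<in>space N. infinite {i\<in>{1..}. \<omega> \<in> S i}}"
    using S by (intro prob_infinitely_often_ge) auto
  with \<open>0 < c\<close> show ?thesis by (simp add: S_def space_N)
qed

end

text \<open>The strict bound \<open>c < 1\<close> excludes the exponent 0.\<close>

lemma exists_large_M:
  fixes q c :: real and d :: nat
  assumes "0 < q" "q \<le> 1" "0 < d" "0 < c" "c < 1"
  shows "\<exists>M > 0. (1 - q / (2 * d)) ^ M \<le> c"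
proof -
  have "1 - q / (2 * d) < 1" using assms by simp
  then obtain M where "(1 - q / (2 * d)) ^ M < c"
    using real_arch_pow_inv[OF assms(4)] by blast
  moreover from this have "M \<noteq> 0" using assms(5) by (cases M) auto
  ultimately show ?thesis by (intro exI[of _ M]) auto
qed

theorem theorem4p1:
  shows
    "(2 \<le> CARD('d::finite) \<longrightarrow>
      (\<forall>pmin :: real. \<exists>M :: nat. \<forall>(p :: nat \<Rightarrow> real) (x :: nat \<Rightarrow> 'd site).
        (\<forall>i\<in>{1..2 ^ CARD('d)}. 0 < p i \<and> p i \<le> 1) \<longrightarrow>
        pmin = Min (p ` {1..2 ^ CARD('d)}) \<longrightarrow>
        inj_on x {1..2 ^ CARD('d)} \<longrightarrow>
        (\<exists>\<gamma> :: real. 0 < \<gamma> \<and> \<gamma> < 1 \<and>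
          (\<forall>(\<mu> :: nat pmf) (\<tau> :: 'd tie_rule) (\<nu> :: real measure).
            measure_pmf.prob \<mu> {M..} \<ge> \<gamma> \<longrightarrow>
            tie_breaking \<tau> \<longrightarrow> prob_space \<nu> \<longrightarrow> sets \<nu> = sets borel \<longrightarrow>
            measure (frog_measure \<mu> p \<nu>)
              {\<omega> \<in> space (frog_measure \<mu> p \<nu>).
                 \<forall>i\<in>{1..2 ^ CARD('d)}. survives {1..2 ^ CARD('d)} x \<tau> \<omega> i} > 0)))) \<and>
     (3 \<le> CARD('d) \<longrightarrow>
      (\<forall>p0 :: real. 0 < p0 \<longrightarrow> p0 \<le> 1 \<longrightarrow>
       (\<exists>M :: nat. \<forall>(p :: nat \<Rightarrow> real) (x :: nat \<Rightarrow> 'd site) (l :: 'd).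
        (\<forall>i\<in>{1..}. 0 < p i \<and> p i \<le> 1) \<longrightarrow>
        (INF i\<in>{1..}. p i) = p0 \<longrightarrow>
        inj_on x {1..} \<longrightarrow>
        (\<forall>i1\<in>{1..}. \<forall>i2\<in>{1..}. \<forall>j. j \<noteq> l \<longrightarrow> x i1 $ j = x i2 $ j) \<longrightarrow>
        (\<exists>\<gamma> :: real. 0 < \<gamma> \<and> \<gamma> < 1 \<and>
          (\<forall>(\<mu> :: nat pmf) (\<tau> :: 'd tie_rule) (\<nu> :: real measure).
            measure_pmf.prob \<mu> {M..} \<ge> \<gamma> \<longrightarrow>
            tie_breaking \<tau> \<longrightarrow> prob_space \<nu> \<longrightarrow> sets \<nu> = sets borel \<longrightarrow>
            measure (frog_measure \<mu> p \<nu>)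
              {\<omega> \<in> space (frog_measure \<mu> p \<nu>).
                 infinite {i\<in>{1..}. survives {1..} x \<tau> \<omega> i}} > 0)))))"
proof (rule conjI; intro impI allI)
  \<comment> \<open>Then \<open>2 ^ CARD('d) * (3 * r) = 1 / 2\<close>, which suits the union bound
    over the types. Both \<open>r\<close> and the threshold \<open>1 - r ^ 4 / 3\<close>, taken as
    \<gamma> in both parts, depend on the dimension only.\<close>
  define r :: real where "r = 1 / (6 * 2 ^ CARD('d))"
  have "1 \<le> (2::real) ^ CARD('d)" by simp
  then have r: "0 < r" "r \<le> 1 / 6" "2 ^ CARD('d) * (3 * r) < 1"
    by (simp_all add: r_def field_simps)
  have "r ^ 4 \<le> 1" using r by (intro power_le_one) auto
  then have \<gamma>: "0 < 1 - r ^ 4 / 3" "1 - r ^ 4 / 3 < 1" "0 < r ^ 4 / 3" "r ^ 4 / 3 < 1"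
    using r(1) by simp_all
  {
    fix pmin :: real
    assume d: "2 \<le> CARD('d)"
    \<comment> \<open>\<open>M\<close> is fixed before \<open>p\<close>, so its bound is conditional
      on \<open>0 < pmin\<close> and \<open>pmin \<le> 1\<close>; both hold once \<open>pmin\<close>
      is a minimum of admissible parameters.\<close>
    obtain M where M: "0 < M" "0 < pmin \<Longrightarrow> pmin \<le> 1 \<Longrightarrow> (1 - pmin / (2 * CARD('d))) ^ M \<le> r ^ 4 / 3"
      using exists_large_M[OF _ _ zero_less_card_finite \<gamma>(3,4), of pmin] by blast
    show "\<exists>M :: nat. \<forall>(p :: nat \<Rightarrow> real) (x :: nat \<Rightarrow> 'd site).
        (\<forall>i\<in>{1..2 ^ CARD('d)}. 0 < p i \<and> p i \<le> 1) \<longrightarrow>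
        pmin = Min (p ` {1..2 ^ CARD('d)}) \<longrightarrow>
        inj_on x {1..2 ^ CARD('d)} \<longrightarrow>
        (\<exists>\<gamma> :: real. 0 < \<gamma> \<and> \<gamma> < 1 \<and>
          (\<forall>(\<mu> :: nat pmf) (\<tau> :: 'd tie_rule) (\<nu> :: real measure).
            measure_pmf.prob \<mu> {M..} \<ge> \<gamma> \<longrightarrow>
            tie_breaking \<tau> \<longrightarrow> prob_space \<nu> \<longrightarrow> sets \<nu> = sets borel \<longrightarrow>
            measure (frog_measure \<mu> p \<nu>)
              {\<omega> \<in> space (frog_measure \<mu> p \<nu>).
                 \<forall>i\<in>{1..2 ^ CARD('d)}. survives {1..2 ^ CARD('d)} x \<tau> \<omega> i} > 0))"
    proof (intro exI[of _ M] allI impI, intro exI[of _ "1 - r ^ 4 / 3"] conjI allI impI)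
      fix p :: "nat \<Rightarrow> real" and x :: "nat \<Rightarrow> 'd site" and \<mu> and \<tau> :: "'d tie_rule"
        and \<nu> :: "real measure"
      assume p: "\<forall>i\<in>{1..2 ^ CARD('d)}. 0 < p i \<and> p i \<le> 1"
        and pmin: "pmin = Min (p ` {1..2 ^ CARD('d)})" and inj: "inj_on x {1..2 ^ CARD('d)}"
        and \<mu>: "1 - r ^ 4 / 3 \<le> measure_pmf.prob \<mu> {M..}" and tie: "tie_breaking \<tau>"
        and \<nu>: "prob_space \<nu>" "sets \<nu> = sets borel"
      interpret frog_law \<mu> p \<nu> "frog_measure \<mu> p \<nu> :: 'd outcome measure"
        by (intro frog_law.intro \<nu> refl)
      have pmin_le: "pmin \<le> p i" if "i \<in> {1..2 ^ CARD('d)}" for i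
        unfolding pmin by (intro Min_le finite_imageI finite_atLeastAtMost imageI that)
      have "pmin \<in> p ` {1..2 ^ CARD('d)}" unfolding pmin by (intro Min_in) auto
      with p have pos: "0 < pmin" "pmin \<le> 1" by auto
      show "0 < measure (frog_measure \<mu> p \<nu>) {\<omega> \<in> space (frog_measure \<mu> p \<nu>).
          \<forall>i\<in>{1..2 ^ CARD('d)}. survives {1..2 ^ CARD('d)} x \<tau> \<omega> i}"
      proof (rule coexistence_of_orthants[OF d _ pos(1) inj tie r M(2)[OF pos] M(1) \<mu>])
        show "pmin \<le> p i \<and> p i \<le> 1" if "i \<in> {1..2 ^ CARD('d)}" for i
          using p pmin_le that by blast
      qed
    qed (use \<gamma> in auto)
  }
  {
    fix p0 :: real
    assume d: "3 \<le> CARD('d)" and p0: "0 < p0" "p0 \<le> 1"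
    obtain M where M: "0 < M" "(1 - p0 / (2 * CARD('d))) ^ M \<le> r ^ 4 / 3"
      using exists_large_M[OF p0 zero_less_card_finite \<gamma>(3,4)] by blast
    show "\<exists>M :: nat. \<forall>(p :: nat \<Rightarrow> real) (x :: nat \<Rightarrow> 'd site) (l :: 'd).
        (\<forall>i\<in>{1..}. 0 < p i \<and> p i \<le> 1) \<longrightarrow>
        (INF i\<in>{1..}. p i) = p0 \<longrightarrow>
        inj_on x {1..} \<longrightarrow>
        (\<forall>i1\<in>{1..}. \<forall>i2\<in>{1..}. \<forall>j. j \<noteq> l \<longrightarrow> x i1 $ j = x i2 $ j) \<longrightarrow>
        (\<exists>\<gamma> :: real. 0 < \<gamma> \<and> \<gamma> < 1 \<and>
          (\<forall>(\<mu> :: nat pmf) (\<tau> :: 'd tie_rule) (\<nu> :: real measure).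
            measure_pmf.prob \<mu> {M..} \<ge> \<gamma> \<longrightarrow>
            tie_breaking \<tau> \<longrightarrow> prob_space \<nu> \<longrightarrow> sets \<nu> = sets borel \<longrightarrow>
            measure (frog_measure \<mu> p \<nu>)
              {\<omega> \<in> space (frog_measure \<mu> p \<nu>).
                 infinite {i\<in>{1..}. survives {1..} x \<tau> \<omega> i}} > 0))"
    proof (intro exI[of _ M] allI impI, intro exI[of _ "1 - r ^ 4 / 3"] conjI allI impI)
      fix p :: "nat \<Rightarrow> real" and x :: "nat \<Rightarrow> 'd site" and l and \<mu> and \<tau> :: "'d tie_rule"
        and \<nu> :: "real measure"
      assume p: "\<forall>i\<in>{1..}. 0 < p i \<and> p i \<le> 1" and inf: "(INF i\<in>{1..}. p i) = p0"
        and inj: "inj_on x {1..}"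
        and line: "\<forall>i1\<in>{1..}. \<forall>i2\<in>{1..}. \<forall>j. j \<noteq> l \<longrightarrow> x i1 $ j = x i2 $ j"
        and \<mu>: "1 - r ^ 4 / 3 \<le> measure_pmf.prob \<mu> {M..}" and tie: "tie_breaking \<tau>"
        and \<nu>: "prob_space \<nu>" "sets \<nu> = sets borel"
      interpret frog_law \<mu> p \<nu> "frog_measure \<mu> p \<nu> :: 'd outcome measure"
        by (intro frog_law.intro \<nu> refl)
      \<comment> \<open>The infimum of a set of reals is a lower bound only if the set is bounded
        below.\<close>
      have "bdd_below (p ` {1..})" using p by (intro bdd_belowI[of _ 0]) (auto simp: less_imp_le)
      then have p0_le: "p0 \<le> p i" if "1 \<le> i" for i
        unfolding inf[symmetric] using that by (intro cINF_lower) auto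
      show "0 < measure (frog_measure \<mu> p \<nu>) {\<omega> \<in> space (frog_measure \<mu> p \<nu>).
          infinite {i\<in>{1..}. survives {1..} x \<tau> \<omega> i}}"
      proof (rule coexistence_on_line[OF d _ p0(1) inj tie _ r(1,2) M(2,1) \<mu>])
        show "p0 \<le> p i \<and> p i \<le> 1" if "1 \<le> i" for i
          using p p0_le that by (meson atLeast_iff)
        show "x i $ k = x j $ k" if "i \<in> {1..}" "j \<in> {1..}" "k \<noteq> l" for i j k
          using line that by blast
      qed
    qed (use \<gamma> in auto)
  }
qed

end
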